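(* Let $(M,d)$ be a complete pointed metric space and let $\mu$ be a positive Radon measure on $\beta\widetilde{M}$ that is $\preccurlyeq$-minimal and concentrated on $\mathcal{R}^+:=\{\zeta\in\beta\widetilde{M}: p_1(\zeta),p_2(\zeta)\in\mathcal{R}(M),\ p_1(\zeta)\ne p_2(\zeta)\}$. Then the marginals are mutually singular: $(p_1)_\sharp\mu\perp(p_2)_\sharp\mu$.
   Context: $\widetilde{M}=\{(x,y)\in M\times M:x\ne y\}$, $\beta\widetilde{M}$ its Stone–Čech compactification; Radon measures on it are identified with $C(\beta\widetilde{M})^*$. $M^u$ is the uniform (Samuel) compactification of $M$; $p_1,p_2:\beta\widetilde{M}\to M^u$ are the continuous extensions of $(x,y)\mapsto x$, $(x,y)\mapsto y$, and $(p_i)_\sharp\mu$ denotes the pushforward measure on $M^u$. $\mathcal{R}(M)=\{\xi\in M^u:\overline{d_0}(\xi)<\infty\}$, where $\overline{d_0}:M^u\to[0,\infty]$ is the continuous extension of $x\mapsto d(x,0)$ ($0$ the base point). $G$ is the set of $g\in C(\beta\widetilde{M})$ with $d(x,y)g(x,y)\le d(x,u)g(x,u)+d(u,y)g(u,y)$ for all distinct $x,u,y\in M$; for positive Radon measures, $\mu\preccurlyeq\nu$ iff $\int g\,d\mu\le\int g\,d\nu$ for all $g\in G$; $\mu$ is $\preccurlyeq$-minimal if every positive $\nu\preccurlyeq\mu$ satisfies $\mu\preccurlyeq\nu$. Throughout, $M$ has at least three distinct points. *)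

theory Defs
  imports "HOL-Analysis.Analysis" "HOL-Probability.Probability"
begin

definition borel_of :: "'a topology \<Rightarrow> 'a measure" where
  "borel_of X = sigma (topspace X) {U. openin X U}"

definition radon_measure :: "'a topology \<Rightarrow> 'a measure \<Rightarrow> bool" where
  "radon_measure X \<mu> \<longleftrightarrow>
     sets \<mu> = sets (borel_of X) \<and> space \<mu> = topspace X \<and> finite_measure \<mu> \<and>
     (\<forall>A \<in> sets \<mu>. emeasure \<mu> A = (SUP K \<in> {K. compactin X K \<and> K \<subseteq> A}. emeasure \<mu> K))"

definition mutually_singular :: "'a measure \<Rightarrow> 'a measure \<Rightarrow> bool" where
  "mutually_singular \<nu>1 \<nu>2 \<longleftrightarrow>
     (\<exists>A \<in> sets \<nu>1. emeasure \<nu>1 A = 0 \<and> emeasure \<nu>2 (space \<nu>2 - A) = 0)"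

definition stone_cech_compactification ::
    "'a topology \<Rightarrow> 'b topology \<Rightarrow> ('a \<Rightarrow> 'b) \<Rightarrow> bool" where
  "stone_cech_compactification X B e \<longleftrightarrow>
     compact_space B \<and> Hausdorff_space B \<and> embedding_map X B e \<and>
     B closure_of (e ` topspace X) = topspace B \<and>
     (\<forall>f. continuous_map X euclideanreal f \<and> bounded (f ` topspace X) \<longrightarrow>
        (\<exists>F. continuous_map B euclideanreal F \<and> (\<forall>x \<in> topspace X. F (e x) = f x)))"

definition uniform_compactification ::
    "'u topology \<Rightarrow> ('a::metric_space \<Rightarrow> 'u) \<Rightarrow> bool" where
  "uniform_compactification U i \<longleftrightarrow>
     compact_space U \<and> Hausdorff_space U \<and> embedding_map euclidean U i \<and>
     U closure_of (range i) = topspace U \<and>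
     (\<forall>f :: 'a \<Rightarrow> real.
        (\<exists>F. continuous_map U euclideanreal F \<and> (\<forall>x. F (i x) = f x)) \<longleftrightarrow>
        (bounded (range f) \<and> uniformly_continuous_on UNIV f))"

definition G_set :: "'b topology \<Rightarrow> ('a::metric_space \<times> 'a \<Rightarrow> 'b) \<Rightarrow> ('b \<Rightarrow> real) set" where
  "G_set B e = {g. continuous_map B euclideanreal g \<and>
     (\<forall>x u y. x \<noteq> u \<and> u \<noteq> y \<and> x \<noteq> y \<longrightarrow>
        dist x y * g (e (x, y)) \<le> dist x u * g (e (x, u)) + dist u y * g (e (u, y)))}"

definition preceq_meas :: "'b topology \<Rightarrow> ('a::metric_space \<times> 'a \<Rightarrow> 'b) \<Rightarrow> 'b measure \<Rightarrow> 'b measure \<Rightarrow> bool" where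
  "preceq_meas B e \<mu> \<nu> \<longleftrightarrow> (\<forall>g \<in> G_set B e. integral\<^sup>L \<mu> g \<le> integral\<^sup>L \<nu> g)"

definition preceq_minimal :: "'b topology \<Rightarrow> ('a::metric_space \<times> 'a \<Rightarrow> 'b) \<Rightarrow> 'b measure \<Rightarrow> bool" where
  "preceq_minimal B e \<mu> \<longleftrightarrow>
     (\<forall>\<nu>. radon_measure B \<nu> \<and> preceq_meas B e \<nu> \<mu> \<longrightarrow> preceq_meas B e \<mu> \<nu>)"

end

theory Submission
  imports Defs "HOL-Real_Asymp.Real_Asymp"
begin

text \<open>By Hahn--Banach and Riesz, minimality of \<open>\<mu>\<close> says that every \<open>g \<in> G\<close> admits \<open>k \<in> G\<close> with
  \<open>k + g \<ge> 0\<close> and \<open>\<integral>(k + g) d\<mu>\<close> as small as desired. Take \<open>d g = min d c\<close>. Off a set of small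
  \<open>\<mu>\<close>-measure, \<open>d\<close> is bounded, \<open>d > c\<close> and \<open>d k\<close> is close to \<open>-c\<close>. If two points \<open>\<zeta>, \<zeta>'\<close> outside
  that set had \<open>p2 \<zeta> = p1 \<zeta>'\<close>, there would be nearby pairs \<open>(x, u)\<close>, \<open>(u', y)\<close> with \<open>u\<close> close to \<open>u'\<close>,
  and the triangle inequality for \<open>d k\<close> would give \<open>-c \<le> d k(x, y) \<le> -2c + small\<close>. So \<open>p1\<close> and \<open>p2\<close>
  have disjoint images on compact sets of almost full measure, and Borel--Cantelli finishes.\<close>

section \<open>Hahn--Banach for spaces of functions\<close>

text \<open>Truncation creates the contradiction: two consecutive steps longer than c cost 2c for
  \<open>min d c\<close>, while the direct step costs at most c. For \<open>d\<close> itself,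
  -d(x,y) \<le> -d(x,u) - d(u,y) could hold, with u metrically between x and y. Two obstacles shape
  the argument. First, \<open>d\<close> may be unbounded, so it need not extend to a real function
  on \<open>B\<close>; distances are read from r = 1/(1+d) instead, and the concentration hypothesis
  becomes 0 < r < 1 almost everywhere. Second, p2 \<zeta> = p1 \<zeta>' only provides middle points
  u and u' that are close, not equal. The gap costs up to d(u,u') sup |k|, and nothing bounds sup
  |k| in advance, so the closeness must be chosen after k. Hence the order of choices: the permitted
  loss of mass fixes two-sided bounds on d, these fix c and the tolerance for k + g, then k is
  found, and only then the closeness of u and u'. The outer points x and y may coincide, so the
  inequality defining G is also needed for degenerate triangles; this is where the third point of
  the space enters.\<close>

definition fun_subspace :: "('b \<Rightarrow> real) set \<Rightarrow> bool" where
  "fun_subspace V \<longleftrightarrow> (\<forall>f\<in>V. \<forall>g\<in>V. (\<lambda>x. f x + g x) \<in> V) \<and> (\<forall>f\<in>V. \<forall>c. (\<lambda>x. c * f x) \<in> V)"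

text \<open>Homogeneity is asked only as an inequality for c > 0, which is convenient to check for
  infima. Equality is recovered in \<open>sublinear_on_scale\<close> by scaling back with 1/c, and
  the value at zero from q 0 \<le> 2 q 0 and q 0 \<le> q 0 / 2.\<close>

definition sublinear_on :: "('b \<Rightarrow> real) set \<Rightarrow> (('b \<Rightarrow> real) \<Rightarrow> real) \<Rightarrow> bool" where
  "sublinear_on V q \<longleftrightarrow>
     (\<forall>f\<in>V. \<forall>g\<in>V. q (\<lambda>x. f x + g x) \<le> q f + q g) \<and>
     (\<forall>f\<in>V. \<forall>c>0. q (\<lambda>x. c * f x) \<le> c * q f)"

lemma fun_subspace_add: "fun_subspace V \<Longrightarrow> f \<in> V \<Longrightarrow> g \<in> V \<Longrightarrow> (\<lambda>x. f x + g x) \<in> V"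
  and fun_subspace_scale: "fun_subspace V \<Longrightarrow> f \<in> V \<Longrightarrow> (\<lambda>x. c * f x) \<in> V"
  by (auto simp: fun_subspace_def)

lemma fun_subspace_uminus: "fun_subspace V \<Longrightarrow> f \<in> V \<Longrightarrow> (\<lambda>x. - f x) \<in> V"
  using fun_subspace_scale[of V f "-1"] by simp

lemma sublinear_on_add:
    "sublinear_on V q \<Longrightarrow> f \<in> V \<Longrightarrow> g \<in> V \<Longrightarrow> q (\<lambda>x. f x + g x) \<le> q f + q g"
  and sublinear_on_scale_le:
    "sublinear_on V q \<Longrightarrow> f \<in> V \<Longrightarrow> c > 0 \<Longrightarrow> q (\<lambda>x. c * f x) \<le> c * q f"
  by (auto simp: sublinear_on_def)

lemma sublinear_on_scale:
  assumes "fun_subspace V" "sublinear_on V q" "f \<in> V" "c \<ge> 0"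
  shows "q (\<lambda>x. c * f x) = c * q f"
proof (cases "c = 0")
  case True
  have z: "(\<lambda>x. 0) \<in> V" using fun_subspace_scale[OF assms(1,3), of 0] by simp
  have "q (\<lambda>x. 0) \<le> q (\<lambda>x. 0) + q (\<lambda>x. 0)" "q (\<lambda>x. 0) \<le> (1/2) * q (\<lambda>x. 0)"
    using sublinear_on_add[OF assms(2) z z] sublinear_on_scale_le[OF assms(2) z, of "1/2"] by simp_all
  then show ?thesis using True by simp
next
  case False
  then have c: "c > 0" using assms by simp
  have "q (\<lambda>x. (1/c) * (c * f x)) \<le> (1/c) * q (\<lambda>x. c * f x)"
    using sublinear_on_scale_le[OF assms(2) fun_subspace_scale[OF assms(1,3)], of "1/c" c] c by simp
  then have "c * q f \<le> q (\<lambda>x. c * f x)" using c by (simp add: field_simps)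
  then show ?thesis using sublinear_on_scale_le[OF assms(2,3) c] by simp
qed

lemma sublinear_on_uminus:
  assumes "fun_subspace V" "sublinear_on V q" "f \<in> V"
  shows "- q (\<lambda>x. - f x) \<le> q f"
  using sublinear_on_add[OF assms(2,3) fun_subspace_uminus[OF assms(1,3)]]
    sublinear_on_scale[OF assms, of 0] by simp

text \<open>A minimal sublinear functional is linear, because the functional constructed here lies below it.\<close>

lemma sublinear_on_shrink:
  assumes V: "fun_subspace V" and q: "sublinear_on V q" and h: "h \<in> V"
  obtains q' where "sublinear_on V q'" "\<And>f. f \<in> V \<Longrightarrow> q' f \<le> q f" "\<And>f. f \<notin> V \<Longrightarrow> q' f = 0"
    "\<And>f. f \<in> V \<Longrightarrow> q' f \<le> q (\<lambda>x. f x + h x) - q h"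
proof -
  \<comment> \<open>Taking t = 0 keeps the infimum below q. Taking t = 1 gives the last conclusion,
    which at f = -h reads q'(-h) \<le> -q h, so that q' is linear along h.\<close>
  define Q where "Q f t = q (\<lambda>x. f x + t * h x) - t * q h" for f t
  \<comment> \<open>With the value 0 off \<open>V\<close>, functionals that agree on
    \<open>V\<close> are equal as total functions; the order used with Zorn's lemma is then
    antisymmetric and minimality yields an equation.\<close>
  define q' where "q' f = (if f \<in> V then INF t\<in>{0..}. Q f t else 0)" for f
  have low: "- q (\<lambda>x. - f x) \<le> Q f t" if f: "f \<in> V" and t: "t \<ge> 0" for f t
  proof -
    have "q (\<lambda>x. (f x + t * h x) + (- f x)) \<le> q (\<lambda>x. f x + t * h x) + q (\<lambda>x. - f x)"
      by (intro sublinear_on_add[OF q] fun_subspace_add[OF V] fun_subspace_uminus[OF V]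
          fun_subspace_scale[OF V] f h)
    then show ?thesis using sublinear_on_scale[OF V q h t] by (simp add: Q_def)
  qed
  have bdd: "bdd_below (Q f ` {0..})" if "f \<in> V" for f
    using low[OF that] by (intro bdd_belowI2) auto
  have le: "q' f \<le> Q f t" if "f \<in> V" "t \<ge> 0" for f t
    using cINF_lower[OF bdd[OF that(1)], of t] that by (simp add: q'_def)
  have close: "\<exists>t\<ge>0. Q f t < q' f + \<epsilon>" if "f \<in> V" "\<epsilon> > 0" for f \<epsilon>
  proof -
    have "(INF t\<in>{0..}. Q f t) < q' f + \<epsilon>" using that by (simp add: q'_def)
    then show ?thesis using cINF_less_iff[OF _ bdd[OF that(1)]] by auto
  qed
  have "sublinear_on V q'"
    unfolding sublinear_on_def
  proof (intro conjI ballI allI impI)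
    fix f g assume f: "f \<in> V" and g: "g \<in> V"
    show "q' (\<lambda>x. f x + g x) \<le> q' f + q' g"
    proof (rule field_le_epsilon)
      fix \<epsilon> :: real assume \<epsilon>: "\<epsilon> > 0"
      obtain s where s: "s \<ge> 0" "Q f s < q' f + \<epsilon>/2" using close[OF f, of "\<epsilon>/2"] \<epsilon> by auto
      obtain t where t: "t \<ge> 0" "Q g t < q' g + \<epsilon>/2" using close[OF g, of "\<epsilon>/2"] \<epsilon> by auto
      have "q (\<lambda>x. (f x + s * h x) + (g x + t * h x)) \<le> q (\<lambda>x. f x + s * h x) + q (\<lambda>x. g x + t * h x)"
        by (intro sublinear_on_add[OF q] fun_subspace_add[OF V] fun_subspace_scale[OF V] f g h)
      then have "Q (\<lambda>x. f x + g x) (s + t) \<le> Q f s + Q g t"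
        by (simp add: Q_def algebra_simps)
      moreover have "q' (\<lambda>x. f x + g x) \<le> Q (\<lambda>x. f x + g x) (s + t)"
        using s t by (intro le fun_subspace_add[OF V] f g) auto
      ultimately show "q' (\<lambda>x. f x + g x) \<le> q' f + q' g + \<epsilon>" using s t by linarith
    qed
  next
    fix f and c :: real assume f: "f \<in> V" and c: "c > 0"
    show "q' (\<lambda>x. c * f x) \<le> c * q' f"
    proof (rule field_le_epsilon)
      fix \<epsilon> :: real assume \<epsilon>: "\<epsilon> > 0"
      obtain s where s: "s \<ge> 0" "Q f s < q' f + \<epsilon>/c" using close[OF f, of "\<epsilon>/c"] \<epsilon> c by auto
      have "q (\<lambda>x. c * (f x + s * h x)) \<le> c * q (\<lambda>x. f x + s * h x)"
        by (intro sublinear_on_scale_le[OF q] fun_subspace_add[OF V] fun_subspace_scale[OF V] f h c)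
      then have "Q (\<lambda>x. c * f x) (c * s) \<le> c * Q f s" by (simp add: Q_def algebra_simps)
      moreover have "q' (\<lambda>x. c * f x) \<le> Q (\<lambda>x. c * f x) (c * s)"
        using s c by (intro le fun_subspace_scale[OF V] f) auto
      moreover have "c * Q f s \<le> c * q' f + \<epsilon>" using s c by (simp add: field_simps)
      ultimately show "q' (\<lambda>x. c * f x) \<le> c * q' f + \<epsilon>" by linarith
    qed
  qed
  moreover have "q' f \<le> q f" if "f \<in> V" for f using le[OF that, of 0] by (simp add: Q_def)
  moreover have "q' f \<le> q (\<lambda>x. f x + h x) - q h" if "f \<in> V" for f
    using le[OF that, of 1] by (simp add: Q_def)
  ultimately show ?thesis using that[of q'] by (simp add: q'_def)
qed

text \<open>Zorn's lemma is applied to all sublinear functionals below p, not to partial linear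
  ones. Chains have pointwise infima because q f \<ge> -q(-f) \<ge> -p(-f), a bound that does not
  depend on q.\<close>

lemma exists_linear_below:
  assumes V: "fun_subspace V" and p: "sublinear_on V p"
  obtains L where "\<And>f g. f \<in> V \<Longrightarrow> g \<in> V \<Longrightarrow> L (\<lambda>x. f x + g x) = L f + L g"
    "\<And>f c. f \<in> V \<Longrightarrow> L (\<lambda>x. c * f x) = c * L f"
    "\<And>f. f \<in> V \<Longrightarrow> L f \<le> p f"
proof -
  define A where "A = {q. sublinear_on V q \<and> (\<forall>f\<in>V. q f \<le> p f) \<and> (\<forall>f. f \<notin> V \<longrightarrow> q f = 0)}"
  \<comment> \<open>The order is reversed, so the maximal element produced by
    \<open>predicate_Zorn\<close> is a minimal functional.\<close>
  define P where "P = (\<lambda>(q :: ('a \<Rightarrow> real) \<Rightarrow> real) q'. \<forall>f. q' f \<le> q f)"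
  have "\<exists>m\<in>A. \<forall>a\<in>A. P m a \<longrightarrow> a = m"
  proof (rule predicate_Zorn)
    show "partial_order_on A (relation_of P A)"
      by (rule partial_order_on_relation_ofI) (auto simp: P_def intro: order.trans, auto intro!: ext order.antisym)
  next
    fix C assume "C \<in> Chains (relation_of P A)"
    then have CA: "C \<subseteq> A" and ch: "\<And>a b. a \<in> C \<Longrightarrow> b \<in> C \<Longrightarrow> P a b \<or> P b a"
      by (auto simp: Chains_def relation_of_def)
    show "\<exists>u\<in>A. \<forall>a\<in>C. P a u"
    proof (cases "C = {}")
      case True
      have "(\<lambda>f. if f \<in> V then p f else 0) \<in> A"
        using p fun_subspace_add[OF V] fun_subspace_scale[OF V] by (auto simp: A_def sublinear_on_def)
      then show ?thesis using True by auto
    next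
      case False
      define u where "u f = (INF q\<in>C. q f)" for f
      have low: "- p (\<lambda>x. - f x) \<le> q f" if "f \<in> V" "q \<in> C" for f q
      proof -
        have "sublinear_on V q" "q (\<lambda>x. - f x) \<le> p (\<lambda>x. - f x)"
          using that CA fun_subspace_uminus[OF V] by (auto simp: A_def)
        then show ?thesis using sublinear_on_uminus[OF V _ that(1)] by fastforce
      qed
      have bdd: "bdd_below ((\<lambda>q. q f) ` C)" for f
      proof (cases "f \<in> V")
        case True then show ?thesis using low by (intro bdd_belowI2) auto
      next
        case False then show ?thesis using CA by (intro bdd_belowI2[of _ 0]) (auto simp: A_def)
      qed
      have le: "u f \<le> q f" if "q \<in> C" for f q
        unfolding u_def using cINF_lower[OF bdd that] .
      have close: "\<exists>q\<in>C. q f < u f + \<epsilon>" if "\<epsilon> > 0" for f \<epsilon>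
      proof -
        have "(INF q\<in>C. q f) < u f + \<epsilon>" using that by (simp add: u_def)
        then show ?thesis using cINF_less_iff[OF False bdd] by auto
      qed
      have "sublinear_on V u"
        unfolding sublinear_on_def
      proof (intro conjI ballI allI impI)
        fix f g assume f: "f \<in> V" and g: "g \<in> V"
        show "u (\<lambda>x. f x + g x) \<le> u f + u g"
        proof (rule field_le_epsilon)
          fix \<epsilon> :: real assume \<epsilon>: "\<epsilon> > 0"
          obtain q1 where q1: "q1 \<in> C" "q1 f < u f + \<epsilon>/2" using close[of "\<epsilon>/2" f] \<epsilon> by auto
          obtain q2 where q2: "q2 \<in> C" "q2 g < u g + \<epsilon>/2" using close[of "\<epsilon>/2" g] \<epsilon> by auto
          \<comment> \<open>An infimum of sublinear functionals is not subadditive in general. In a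
            chain, the smaller of q1 and q2 serves f and g at the same time.\<close>
          have "\<exists>q\<in>C. q f \<le> q1 f \<and> q g \<le> q2 g"
            using ch[OF q1(1) q2(1)] q1(1) q2(1) by (auto simp: P_def)
          then obtain q where q: "q \<in> C" "q f \<le> q1 f" "q g \<le> q2 g" by auto
          have "q (\<lambda>x. f x + g x) \<le> q f + q g"
            using q(1) CA f g by (auto simp: A_def sublinear_on_add)
          then show "u (\<lambda>x. f x + g x) \<le> u f + u g + \<epsilon>"
            using le[OF q(1), of "\<lambda>x. f x + g x"] q q1 q2 by linarith
        qed
      next
        fix f and c :: real assume f: "f \<in> V" and c: "c > 0"
        show "u (\<lambda>x. c * f x) \<le> c * u f"
        proof (rule field_le_epsilon)
          fix \<epsilon> :: real assume \<epsilon>: "\<epsilon> > 0"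
          obtain q where q: "q \<in> C" "q f < u f + \<epsilon>/c" using close[of "\<epsilon>/c" f] \<epsilon> c by auto
          have "q (\<lambda>x. c * f x) \<le> c * q f"
            using q(1) CA f c by (auto simp: A_def sublinear_on_scale_le)
          moreover have "c * q f \<le> c * u f + \<epsilon>" using q c by (simp add: field_simps)
          ultimately show "u (\<lambda>x. c * f x) \<le> c * u f + \<epsilon>" using le[OF q(1), of "\<lambda>x. c * f x"] by linarith
        qed
      qed
      moreover have "u f \<le> p f" if "f \<in> V" for f
      proof -
        obtain q where "q \<in> C" using False by auto
        then have "u f \<le> q f" "q f \<le> p f" using le CA that by (auto simp: A_def)
        then show ?thesis by linarith
      qed
      moreover have "u f = 0" if "f \<notin> V" for f
      proof -
        have "(\<lambda>q. q f) ` C = {0}" using CA that False by (force simp: A_def)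
        then show ?thesis by (simp add: u_def)
      qed
      ultimately have "u \<in> A" by (auto simp: A_def)
      then show ?thesis using le by (auto simp: P_def)
    qed
  qed
  then obtain m where mA: "m \<in> A" and mm: "\<And>a. a \<in> A \<Longrightarrow> P m a \<Longrightarrow> a = m" by blast
  have m: "sublinear_on V m" and mp: "\<And>f. f \<in> V \<Longrightarrow> m f \<le> p f" and m0: "\<And>f. f \<notin> V \<Longrightarrow> m f = 0"
    using mA by (auto simp: A_def)
  have super: "m f + m g \<le> m (\<lambda>x. f x + g x)" if f: "f \<in> V" and g: "g \<in> V" for f g
  proof -
    obtain q' where q': "sublinear_on V q'" "\<And>f. f \<in> V \<Longrightarrow> q' f \<le> m f" "\<And>f. f \<notin> V \<Longrightarrow> q' f = 0"
      "\<And>f. f \<in> V \<Longrightarrow> q' f \<le> m (\<lambda>x. f x + g x) - m g"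
      using sublinear_on_shrink[OF V m g] by blast
    have "q' \<in> A" using q'(1-3) mp order.trans by (fastforce simp: A_def)
    moreover have "P m q'" unfolding P_def using q'(2,3) m0 by (metis order.refl)
    ultimately have "q' = m" using mm by blast
    then show ?thesis using q'(4)[OF f] by simp
  qed
  have add: "m (\<lambda>x. f x + g x) = m f + m g" if "f \<in> V" "g \<in> V" for f g
    using super[OF that] sublinear_on_add[OF m that] by linarith
  have neg: "m (\<lambda>x. - f x) = - m f" if "f \<in> V" for f
    using add[OF that fun_subspace_uminus[OF V that]] sublinear_on_scale[OF V m that, of 0] by simp
  have "m (\<lambda>x. c * f x) = c * m f" if f: "f \<in> V" for f c
  proof (cases "c \<ge> 0")
    case False
    have "m (\<lambda>x. - (- c * f x)) = - m (\<lambda>x. - c * f x)"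
      by (intro neg fun_subspace_scale[OF V] f)
    also have "m (\<lambda>x. - c * f x) = - c * m f" using sublinear_on_scale[OF V m f, of "-c"] False by simp
    finally show ?thesis by simp
  qed (use sublinear_on_scale[OF V m f] in simp)
  then show ?thesis using that add mp by blast
qed

text \<open>Instead of extending from the line through h, p is first shrunk along h. Any linear L
  below the shrunken q has L(-h) \<le> q(-h) \<le> p 0 - p h = -p h, and therefore attains p at
  h.\<close>

theorem hahn_banach_functions:
  assumes V: "fun_subspace V" and p: "sublinear_on V p" and h: "h \<in> V"
  obtains L where "\<And>f g. f \<in> V \<Longrightarrow> g \<in> V \<Longrightarrow> L (\<lambda>x. f x + g x) = L f + L g"
    "\<And>f c. f \<in> V \<Longrightarrow> L (\<lambda>x. c * f x) = c * L f"
    "\<And>f. f \<in> V \<Longrightarrow> L f \<le> p f"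
    "L h = p h"
proof -
  obtain q where q: "sublinear_on V q" "\<And>f. f \<in> V \<Longrightarrow> q f \<le> p f"
      "\<And>f. f \<in> V \<Longrightarrow> q f \<le> p (\<lambda>x. f x + h x) - p h"
    using sublinear_on_shrink[OF V p h] by metis
  obtain L where L: "\<And>f g. f \<in> V \<Longrightarrow> g \<in> V \<Longrightarrow> L (\<lambda>x. f x + g x) = L f + L g"
    "\<And>f c. f \<in> V \<Longrightarrow> L (\<lambda>x. c * f x) = c * L f" "\<And>f. f \<in> V \<Longrightarrow> L f \<le> q f"
    using exists_linear_below[OF V q(1)] by blast
  have nh: "(\<lambda>x. - h x) \<in> V" by (rule fun_subspace_uminus[OF V h])
  have "L (\<lambda>x. - h x) \<le> - p h"
    using L(3)[OF nh] q(3)[OF nh] sublinear_on_scale[OF V p h, of 0] by simp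
  then have "L h \<ge> p h" using L(2)[OF h, of "-1"] by simp
  moreover have "L f \<le> p f" if "f \<in> V" for f using L(3)[OF that] q(2)[OF that] by linarith
  ultimately show ?thesis using L h that[of L] by force
qed

section \<open>Riesz representation on compact Hausdorff spaces\<close>

definition cont_funs :: "'b topology \<Rightarrow> ('b \<Rightarrow> real) set" where
  "cont_funs B = {f. continuous_map B euclideanreal f}"

lemma fun_subspace_cont_funs: "fun_subspace (cont_funs B)"
  by (auto simp: fun_subspace_def cont_funs_def intro: continuous_map_add continuous_map_real_mult_left)

lemma cont_funs_const [intro]: "(\<lambda>x. c) \<in> cont_funs B"
  by (simp add: cont_funs_def)

lemma cont_funs_add [intro]: "f \<in> cont_funs B \<Longrightarrow> g \<in> cont_funs B \<Longrightarrow> (\<lambda>x. f x + g x) \<in> cont_funs B"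
  and cont_funs_diff [intro]: "f \<in> cont_funs B \<Longrightarrow> g \<in> cont_funs B \<Longrightarrow> (\<lambda>x. f x - g x) \<in> cont_funs B"
  and cont_funs_mult [intro]: "f \<in> cont_funs B \<Longrightarrow> g \<in> cont_funs B \<Longrightarrow> (\<lambda>x. f x * g x) \<in> cont_funs B"
  and cont_funs_uminus [intro]: "f \<in> cont_funs B \<Longrightarrow> (\<lambda>x. - f x) \<in> cont_funs B"
  and cont_funs_max [intro]: "f \<in> cont_funs B \<Longrightarrow> g \<in> cont_funs B \<Longrightarrow> (\<lambda>x. max (f x) (g x)) \<in> cont_funs B"
  and cont_funs_min [intro]: "f \<in> cont_funs B \<Longrightarrow> g \<in> cont_funs B \<Longrightarrow> (\<lambda>x. min (f x) (g x)) \<in> cont_funs B"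
  by (auto simp: cont_funs_def intro: continuous_map_add continuous_map_diff continuous_map_real_mult
      continuous_map_minus continuous_map_real_max continuous_map_real_min)

lemma cont_funs_sum [intro]:
  "(\<And>i. i \<in> I \<Longrightarrow> f i \<in> cont_funs B) \<Longrightarrow> (\<lambda>x. \<Sum>i\<in>I. f i x) \<in> cont_funs B"
  by (induction I rule: infinite_finite_induct) auto

lemma openin_cont_funs_vimage:
  "f \<in> cont_funs B \<Longrightarrow> open S \<Longrightarrow> openin B {x \<in> topspace B. f x \<in> S}"
  by (simp add: cont_funs_def continuous_map_def)

lemma openin_cont_funs_greater: "f \<in> cont_funs B \<Longrightarrow> openin B {x \<in> topspace B. c < f x}"
  using openin_cont_funs_vimage[of f B "{c<..}"] by simp

lemma openin_cont_funs_less: "f \<in> cont_funs B \<Longrightarrow> openin B {x \<in> topspace B. f x < c}"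
  using openin_cont_funs_vimage[of f B "{..<c}"] by simp

lemma closedin_cont_funs_ge: "f \<in> cont_funs B \<Longrightarrow> closedin B {x \<in> topspace B. c \<le> f x}"
proof -
  assume "f \<in> cont_funs B"
  moreover have "{x \<in> topspace B. c \<le> f x} = topspace B - {x \<in> topspace B. f x < c}" by auto
  ultimately show ?thesis using openin_cont_funs_less by (metis openin_closedin_eq closedin_diff closedin_topspace)
qed

lemma cont_funs_bounded:
  assumes "compact_space B" "f \<in> cont_funs B"
  obtains b where "b > 0" "\<And>x. x \<in> topspace B \<Longrightarrow> \<bar>f x\<bar> \<le> b"
proof -
  have "compactin euclideanreal (f ` topspace B)"
    using assms image_compactin by (force simp: compact_space_def cont_funs_def)
  then have "bounded (f ` topspace B)" by (simp add: compact_imp_bounded)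
  then show ?thesis using that unfolding bounded_pos by auto
qed

lemma sets_borel_of: "sets (borel_of X) = sigma_sets (topspace X) {U. openin X U}"
  and space_borel_of [simp]: "space (borel_of X) = topspace X"
  using openin_subset by (auto simp: borel_of_def intro!: sets_measure_of space_measure_of)

lemma openin_sets_borel_of: "openin X U \<Longrightarrow> U \<in> sets (borel_of X)"
  by (simp add: sets_borel_of)

lemma closedin_sets_borel_of: "closedin X U \<Longrightarrow> U \<in> sets (borel_of X)"
  using sets.compl_sets[of "topspace X - U" "borel_of X"]
  by (simp add: closedin_def openin_sets_borel_of double_diff)

lemma continuous_map_measurable_borel_of:
  assumes "continuous_map X Y f" "sets \<mu> = sets (borel_of X)"
  shows "f \<in> measurable \<mu> (borel_of Y)"
proof -
  have "space \<mu> = topspace X" using sets_eq_imp_space_eq[OF assms(2)] by simp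
  moreover have "f \<in> measurable \<mu> (sigma (topspace Y) {U. openin Y U})"
  proof (rule measurable_sigma_sets)
    show "{U. openin Y U} \<subseteq> Pow (topspace Y)" using openin_subset by auto
    show "f \<in> space \<mu> \<rightarrow> topspace Y" using assms(1) \<open>space \<mu> = _\<close> by (auto simp: continuous_map_def)
    fix U assume "U \<in> {U. openin Y U}"
    then have "openin X {x \<in> topspace X. f x \<in> U}" using assms(1) by (simp add: continuous_map_def)
    moreover have "f -` U \<inter> space \<mu> = {x \<in> topspace X. f x \<in> U}" using \<open>space \<mu> = _\<close> by auto
    ultimately show "f -` U \<inter> space \<mu> \<in> sets \<mu>"
      by (simp add: assms(2) openin_sets_borel_of)
  qed (use openin_subset in \<open>auto intro!: sets_measure_of\<close>)
  ultimately show ?thesis by (simp add: borel_of_def)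
qed

lemma cont_funs_borel_measurable:
  assumes "f \<in> cont_funs B" "sets \<mu> = sets (borel_of B)"
  shows "f \<in> borel_measurable \<mu>"
proof (rule borel_measurableI)
  fix S :: "real set" assume "open S"
  have "f -` S \<inter> space \<mu> = {x \<in> topspace B. f x \<in> S}"
    using sets_eq_imp_space_eq[OF assms(2)] by auto
  then show "f -` S \<inter> space \<mu> \<in> sets \<mu>"
    using openin_sets_borel_of[OF openin_cont_funs_vimage[OF assms(1) \<open>open S\<close>]] by (simp add: assms(2))
qed

lemma cont_funs_integrable:
  assumes "compact_space B" "f \<in> cont_funs B" "finite_measure \<mu>" "sets \<mu> = sets (borel_of B)"
  shows "integrable \<mu> f"
proof -
  obtain b where b: "b > 0" "\<And>x. x \<in> topspace B \<Longrightarrow> \<bar>f x\<bar> \<le> b"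
    using cont_funs_bounded[OF assms(1,2)] by blast
  interpret finite_measure \<mu> by fact
  show ?thesis
    using b(2) sets_eq_imp_space_eq[OF assms(4)]
    by (intro integrable_const_bound[of f b] cont_funs_borel_measurable[OF assms(2,4)]) auto
qed

section \<open>The content of open sets induced by a positive functional\<close>

locale positive_functional =
  fixes B :: "'b topology" and L :: "('b \<Rightarrow> real) \<Rightarrow> real"
  assumes compact: "compact_space B" and Hausdorff: "Hausdorff_space B"
    and add: "\<And>f g. f \<in> cont_funs B \<Longrightarrow> g \<in> cont_funs B \<Longrightarrow> L (\<lambda>x. f x + g x) = L f + L g"
    and scale: "\<And>f c. f \<in> cont_funs B \<Longrightarrow> L (\<lambda>x. c * f x) = c * L f"
    and nonneg: "\<And>f. f \<in> cont_funs B \<Longrightarrow> (\<And>x. x \<in> topspace B \<Longrightarrow> 0 \<le> f x) \<Longrightarrow> 0 \<le> L f"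
begin

lemma diff: "f \<in> cont_funs B \<Longrightarrow> g \<in> cont_funs B \<Longrightarrow> L (\<lambda>x. f x - g x) = L f - L g"
  using add[of f "\<lambda>x. -1 * g x"] scale[of g "-1"] cont_funs_uminus[of g] by simp

lemma mono:
  assumes "f \<in> cont_funs B" "g \<in> cont_funs B" "\<And>x. x \<in> topspace B \<Longrightarrow> f x \<le> g x"
  shows "L f \<le> L g"
  using nonneg[of "\<lambda>x. g x - f x"] diff[OF assms(2,1)] assms by fastforce

lemma const: "L (\<lambda>x. c) = c * L (\<lambda>x. 1)"
  using scale[of "\<lambda>x. 1" c] by auto

lemma sum:
  "(\<And>i. i \<in> I \<Longrightarrow> f i \<in> cont_funs B) \<Longrightarrow> L (\<lambda>x. \<Sum>i\<in>I. f i x) = (\<Sum>i\<in>I. L (f i))"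
  by (induction I rule: infinite_finite_induct) (auto simp: const[of 0] add cont_funs_sum)

lemma one_nonneg: "0 \<le> L (\<lambda>x. 1)"
  by (rule nonneg) auto

text \<open>Vanishing off \<open>V\<close> replaces the usual requirement that the support lie in
  \<open>V\<close>; where compactness is used, truncation restores a closed set inside
  \<open>V\<close> that carries the function.\<close>

definition below :: "'b set \<Rightarrow> ('b \<Rightarrow> real) set" where
  "below V = {f \<in> cont_funs B. (\<forall>x\<in>topspace B. 0 \<le> f x \<and> f x \<le> 1) \<and> (\<forall>x\<in>topspace B - V. f x = 0)}"

definition content :: "'b set \<Rightarrow> ennreal" where
  "content V = (SUP f\<in>below V. ennreal (L f))"

lemma content_upper: "f \<in> below V \<Longrightarrow> ennreal (L f) \<le> content V"
  unfolding content_def by (rule SUP_upper)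

lemma zero_below: "(\<lambda>x. 0) \<in> below V"
  by (auto simp: below_def)

lemma content_mono: "V \<subseteq> W \<Longrightarrow> content V \<le> content W"
  unfolding content_def by (rule SUP_subset_mono) (auto simp: below_def)

lemma content_empty [simp]: "content {} = 0"
proof -
  have "L f \<le> 0" if "f \<in> below {}" for f
    using mono[of f "\<lambda>x. 0"] that const[of 0] by (auto simp: below_def)
  then have "content {} \<le> 0"
    unfolding content_def by (intro SUP_least) (simp add: ennreal_neg)
  then show ?thesis by simp
qed

lemma content_topspace: "content (topspace B) = ennreal (L (\<lambda>x. 1))"
proof (rule antisym)
  show "content (topspace B) \<le> ennreal (L (\<lambda>x. 1))"
    unfolding content_def by (intro SUP_least ennreal_leI mono) (auto simp: below_def)
  show "ennreal (L (\<lambda>x. 1)) \<le> content (topspace B)"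
    by (rule content_upper) (auto simp: below_def)
qed

text \<open>Replacing \<open>f\<close> by its truncation \<open>(f - \<epsilon>)\<^sup>+\<close> makes the support compact at a cost of \<open>\<epsilon> L(1)\<close>.\<close>

definition trunc :: "real \<Rightarrow> ('b \<Rightarrow> real) \<Rightarrow> 'b \<Rightarrow> real" where
  "trunc \<epsilon> f = (\<lambda>x. max (f x - \<epsilon>) 0)"

lemma trunc_below: "f \<in> below V \<Longrightarrow> \<epsilon> > 0 \<Longrightarrow> trunc \<epsilon> f \<in> below V"
  by (fastforce simp: below_def trunc_def)

lemma L_trunc: "f \<in> cont_funs B \<Longrightarrow> L f \<le> L (trunc \<epsilon> f) + \<epsilon> * L (\<lambda>x. 1)"
  using mono[of f "\<lambda>x. trunc \<epsilon> f x + \<epsilon>"] add[of "trunc \<epsilon> f" "\<lambda>x. \<epsilon>"] const[of \<epsilon>]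
  by (fastforce simp: trunc_def)

text \<open>The later upper bounds on contents start from this rule: a truncation vanishes off the
  compact set where f \<ge> \<epsilon>, and that set lies inside \<open>V\<close>.\<close>

lemma content_least:
  assumes "\<And>f \<epsilon>. f \<in> below V \<Longrightarrow> \<epsilon> > 0 \<Longrightarrow> ennreal (L (trunc \<epsilon> f)) \<le> c"
  shows "content V \<le> c"
  unfolding content_def
proof (rule SUP_least)
  fix f assume f: "f \<in> below V"
  show "ennreal (L f) \<le> c"
  proof (rule ennreal_le_epsilon)
    fix e :: real assume e: "e > 0"
    \<comment> \<open>The summand 1 keeps the denominator positive when L vanishes on
      constants.\<close>
    define \<epsilon> where "\<epsilon> = e / (L (\<lambda>x. 1) + 1)"
    have \<epsilon>: "\<epsilon> > 0" "\<epsilon> * L (\<lambda>x. 1) \<le> e"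
      using e one_nonneg by (auto simp: \<epsilon>_def field_simps)
    have "0 \<le> L (trunc \<epsilon> f)"
      using trunc_below[OF f \<epsilon>(1)] by (intro nonneg) (auto simp: below_def)
    moreover have "L f \<le> L (trunc \<epsilon> f) + e" using L_trunc[of f \<epsilon>] f \<epsilon> by (auto simp: below_def)
    ultimately have "ennreal (L f) \<le> ennreal (L (trunc \<epsilon> f)) + ennreal e"
      using e by (simp flip: ennreal_plus add: ennreal_leI)
    also have "\<dots> \<le> c + ennreal e" using assms[OF f \<epsilon>(1)] by (rule add_right_mono)
    finally show "ennreal (L f) \<le> c + ennreal e" .
  qed
qed

text \<open>A Urysohn function h, equal to 0 off \<open>W\<close> and to 1 on the part of K outside
  \<open>V\<close>, splits the truncation t into t(1-h), which vanishes off \<open>V\<close>, and t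
  h, which vanishes off \<open>W\<close>.\<close>

lemma content_Un:
  assumes V: "openin B V" and W: "openin B W"
  shows "content (V \<union> W) \<le> content V + content W"
proof (rule content_least)
  fix f and \<epsilon> :: real assume f: "f \<in> below (V \<union> W)" and \<epsilon>: "\<epsilon> > 0"
  define K where "K = {x \<in> topspace B. \<epsilon> \<le> f x}"
  have fc: "f \<in> cont_funs B" using f by (simp add: below_def)
  have K: "closedin B K" unfolding K_def by (rule closedin_cont_funs_ge[OF fc])
  have KVW: "K \<subseteq> V \<union> W" using f \<epsilon> by (force simp: K_def below_def)
  have cl: "closedin B (topspace B - W)" "closedin B (K - V)"
    using K V W by (auto intro: closedin_diff)
  have "disjnt (topspace B - W) (K - V)" using KVW by (auto simp: disjnt_def)
  then obtain h where h: "continuous_map B (top_of_set {0..1}) h"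
      "h ` (topspace B - W) \<subseteq> {0::real}" "h ` (K - V) \<subseteq> {1}"
    using Urysohn_lemma[OF _ cl, of 0 1] compact_Hausdorff_or_regular_imp_normal_space[OF compact] Hausdorff
    by (metis zero_le_one)
  have hc: "h \<in> cont_funs B" and h01: "\<And>x. x \<in> topspace B \<Longrightarrow> 0 \<le> h x \<and> h x \<le> 1"
    using h(1) by (auto simp: cont_funs_def continuous_map_in_subtopology)
  define t where "t = trunc \<epsilon> f"
  have t: "t \<in> below (V \<union> W)" unfolding t_def by (rule trunc_below[OF f \<epsilon>])
  have tK: "t x = 0" if "x \<in> topspace B - K" for x using that by (auto simp: t_def trunc_def K_def)
  have tc: "t \<in> cont_funs B" and t01: "\<And>x. x \<in> topspace B \<Longrightarrow> 0 \<le> t x \<and> t x \<le> 1"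
    using t by (auto simp: below_def)
  have 1: "(\<lambda>x. t x * (1 - h x)) \<in> below V"
  proof -
    have "t x * (1 - h x) = 0" if "x \<in> topspace B - V" for x
      using that h(3) tK[of x] by (cases "x \<in> K") auto
    moreover have "(\<lambda>x. t x * (1 - h x)) \<in> cont_funs B"
      by (rule cont_funs_mult[OF tc cont_funs_diff[OF cont_funs_const hc]])
    ultimately show ?thesis using t01 h01 by (fastforce simp: below_def intro!: mult_le_one)
  qed
  have 2: "(\<lambda>x. t x * h x) \<in> below W"
    using tc hc t01 h01 h(2) by (auto simp: below_def intro!: mult_le_one)
  have c: "(\<lambda>x. t x * (1 - h x)) \<in> cont_funs B" "(\<lambda>x. t x * h x) \<in> cont_funs B"
    by (rule cont_funs_mult[OF tc cont_funs_diff[OF cont_funs_const hc]], rule cont_funs_mult[OF tc hc])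
  have "L t = L (\<lambda>x. t x * (1 - h x) + t x * h x)" by (simp add: algebra_simps)
  also have "\<dots> = L (\<lambda>x. t x * (1 - h x)) + L (\<lambda>x. t x * h x)" by (rule add[OF c])
  finally have "ennreal (L t) = ennreal (L (\<lambda>x. t x * (1 - h x))) + ennreal (L (\<lambda>x. t x * h x))"
    using nonneg[OF c(1)] nonneg[OF c(2)] t01 h01 by (simp add: ennreal_plus)
  also have "\<dots> \<le> content V + content W"
    by (intro add_mono content_upper 1 2)
  finally show "ennreal (L (trunc \<epsilon> f)) \<le> content V + content W" by (simp add: t_def)
qed

lemma content_finite_UN:
  "finite I \<Longrightarrow> (\<And>i. i \<in> I \<Longrightarrow> openin B (V i)) \<Longrightarrow> content (\<Union>i\<in>I. V i) \<le> (\<Sum>i\<in>I. content (V i))"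
proof (induction I rule: finite_induct)
  case (insert j I)
  have "content (V j \<union> (\<Union>i\<in>I. V i)) \<le> content (V j) + content (\<Union>i\<in>I. V i)"
    using insert by (intro content_Un) auto
  also have "\<dots> \<le> content (V j) + (\<Sum>i\<in>I. content (V i))"
    using insert by (intro add_left_mono) auto
  finally show ?case using insert by simp
qed simp

text \<open>The set where f \<ge> \<epsilon> is compact and covered by the \<open>V n\<close>, so
  the truncation already lives on a finite union.\<close>

lemma content_countable_UN:
  assumes V: "\<And>n::nat. openin B (V n)"
  shows "content (\<Union>n. V n) \<le> (\<Sum>n. content (V n))"
proof (rule content_least)
  fix f and \<epsilon> :: real assume f: "f \<in> below (\<Union>n. V n)" and \<epsilon>: "\<epsilon> > 0"
  define K where "K = {x \<in> topspace B. \<epsilon> \<le> f x}"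
  have "closedin B K" unfolding K_def by (rule closedin_cont_funs_ge) (use f in \<open>simp add: below_def\<close>)
  then have "compactin B K" by (rule closedin_compact_space[OF compact])
  moreover have "K \<subseteq> \<Union> (range V)" using f \<epsilon> by (force simp: K_def below_def)
  moreover have "\<forall>W\<in>range V. openin B W" using V by auto
  ultimately obtain F where F: "finite F" "F \<subseteq> range V" "K \<subseteq> \<Union> F"
    unfolding compactin_def by meson
  then obtain I where I: "finite I" "F = V ` I" by (metis finite_subset_image)
  have "trunc \<epsilon> f \<in> below (\<Union>i\<in>I. V i)"
    using trunc_below[OF f \<epsilon>] F(3) I(2) by (auto simp: below_def trunc_def K_def)
  then have "ennreal (L (trunc \<epsilon> f)) \<le> content (\<Union>i\<in>I. V i)" by (rule content_upper)
  also have "\<dots> \<le> (\<Sum>i\<in>I. content (V i))" by (rule content_finite_UN[OF I(1) V])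
  also have "\<dots> \<le> (\<Sum>n. content (V n))" by (rule sum_le_suminf) (auto intro: I)
  finally show "ennreal (L (trunc \<epsilon> f)) \<le> (\<Sum>n. content (V n))" .
qed

section \<open>The outer measure and Caratheodory measurability of open sets\<close>

definition outer :: "'b set \<Rightarrow> ennreal" where
  "outer E = (INF V\<in>{V. openin B V \<and> E \<subseteq> V}. content V)"

lemma outer_lower: "openin B V \<Longrightarrow> E \<subseteq> V \<Longrightarrow> outer E \<le> content V"
  unfolding outer_def by (rule INF_lower) simp

lemma outer_open: "openin B V \<Longrightarrow> outer V = content V"
  by (intro antisym outer_lower) (auto simp: outer_def intro!: INF_greatest content_mono)

lemma outer_mono: "E \<subseteq> F \<Longrightarrow> outer E \<le> outer F"
  unfolding outer_def by (rule INF_superset_mono) auto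

lemma outer_finite: "E \<subseteq> topspace B \<Longrightarrow> outer E < \<infinity>"
  using outer_lower[of "topspace B" E] content_topspace by (simp add: order_le_less_trans)

lemma outer_close:
  assumes "E \<subseteq> topspace B" "\<epsilon> > 0"
  obtains V where "openin B V" "E \<subseteq> V" "content V < outer E + ennreal \<epsilon>"
proof -
  have "outer E < outer E + ennreal \<epsilon>"
    using outer_finite[OF assms(1)] assms(2) by (simp add: ennreal_less_iff less_top)
  then show ?thesis using that unfolding outer_def[of E] INF_less_iff by (auto simp: outer_def)
qed

lemma outer_measure_space_outer: "outer_measure_space (Pow (topspace B)) outer"
  unfolding outer_measure_space_def
proof (intro conjI)
  show "positive (Pow (topspace B)) outer" using outer_open[of "{}"] by (simp add: positive_def)
  show "increasing (Pow (topspace B)) outer" by (simp add: increasing_def outer_mono)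
  show "countably_subadditive (Pow (topspace B)) outer"
    unfolding countably_subadditive_def
  proof (intro allI impI)
    fix A :: "nat \<Rightarrow> 'b set" assume A: "range A \<subseteq> Pow (topspace B)"
    show "outer (\<Union>i. A i) \<le> (\<Sum>i. outer (A i))"
    proof (rule ennreal_le_epsilon)
      fix e :: real assume e: "e > 0"
      have "\<exists>V. openin B V \<and> A n \<subseteq> V \<and> content V < outer (A n) + ennreal (e * (1/2) ^ Suc n)" for n
      proof -
        have "A n \<subseteq> topspace B" "e * (1/2) ^ Suc n > 0" using A e by auto
        from outer_close[OF this] show ?thesis by metis
      qed
      then obtain V where V: "\<And>n. openin B (V n)" "\<And>n. A n \<subseteq> V n"
          "\<And>n. content (V n) < outer (A n) + ennreal (e * (1/2) ^ Suc n)" by metis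
      have "outer (\<Union>i. A i) \<le> content (\<Union>i. V i)" using V by (intro outer_lower) auto
      also have "\<dots> \<le> (\<Sum>i. content (V i))" by (rule content_countable_UN[OF V(1)])
      also have "\<dots> \<le> (\<Sum>i. outer (A i) + ennreal (e * (1/2) ^ Suc i))"
        using V(3) by (intro suminf_le) (auto intro: less_imp_le)
      also have "\<dots> = (\<Sum>i. outer (A i)) + (\<Sum>i. ennreal (e * (1/2) ^ Suc i))"
        by (rule suminf_add[symmetric]) auto
      also have "(\<Sum>i. ennreal (e * (1/2) ^ Suc i)) = ennreal (\<Sum>i. e * (1/2) ^ Suc i)"
        using e sums_mult[OF power_half_series] by (intro suminf_ennreal2) (auto simp: sums_iff)
      also have "(\<Sum>i. e * (1/2) ^ Suc i) = e"
        using sums_mult[OF power_half_series, of e] by (simp add: sums_iff)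
      finally show "outer (\<Union>i. A i) \<le> (\<Sum>i. outer (A i)) + ennreal e" .
    qed
  qed
qed

lemma outer_Un: "E \<subseteq> topspace B \<Longrightarrow> F \<subseteq> topspace B \<Longrightarrow> outer (E \<union> F) \<le> outer E + outer F"
proof -
  assume E: "E \<subseteq> topspace B" "F \<subseteq> topspace B"
  interpret algebra "topspace B" "Pow (topspace B)" by (rule algebra_Pow)
  have "subadditive (Pow (topspace B)) outer"
    using outer_measure_space_outer
    by (intro countably_subadditive_subadditive) (auto simp: outer_measure_space_def)
  then have "outer (E \<union> (F - E)) \<le> outer E + outer (F - E)"
    by (rule subadditiveD) (use E in auto)
  also have "\<dots> \<le> outer E + outer F" by (intro add_left_mono outer_mono) auto
  finally show ?thesis by simp
qed

text \<open>This is the Caratheodory inequality for open test sets. A truncation carried by a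
  compact K inside V \<inter> W and a function vanishing off V - K are never nonzero together, so
  their sum stays at most 1 and competes for the content of \<open>V\<close>. Suprema over both
  functions finish the proof, since V - W is contained in V - K.\<close>

lemma open_split:
  assumes W: "openin B W" and V: "openin B V"
  shows "outer (V \<inter> W) + outer (V - W) \<le> content V"
proof -
  have VW: "openin B (V \<inter> W)" using V W by auto
  have key: "ennreal (L (trunc \<epsilon> f)) + outer (V - W) \<le> content V"
    if f: "f \<in> below (V \<inter> W)" and \<epsilon>: "\<epsilon> > 0" for f \<epsilon>
  proof -
    define K where "K = {x \<in> topspace B. \<epsilon> \<le> f x}"
    have fc: "f \<in> cont_funs B" using f by (simp add: below_def)
    have K: "closedin B K" unfolding K_def by (rule closedin_cont_funs_ge[OF fc])
    have KVW: "K \<subseteq> V \<inter> W" using f \<epsilon> by (force simp: K_def below_def)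
    have "outer (V - W) \<le> content (V - K)" using V K KVW by (intro outer_lower) auto
    moreover have "ennreal (L (trunc \<epsilon> f)) + content (V - K) \<le> content V"
    proof -
      have "ennreal (L (trunc \<epsilon> f)) + ennreal (L h) \<le> content V" if h: "h \<in> below (V - K)" for h
      proof -
        have t: "trunc \<epsilon> f \<in> below (V \<inter> W)" by (rule trunc_below[OF f \<epsilon>])
        have c: "trunc \<epsilon> f \<in> cont_funs B" "h \<in> cont_funs B" using t h by (auto simp: below_def)
        have "(\<lambda>x. trunc \<epsilon> f x + h x) \<in> below V"
        proof -
          have "trunc \<epsilon> f x + h x \<le> 1" if "x \<in> topspace B" for x
          proof (cases "x \<in> K")
            case True then show ?thesis using h t that by (auto simp: below_def)
          next
            case False
            then have "trunc \<epsilon> f x = 0" using that by (auto simp: K_def trunc_def)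
            then show ?thesis using h that by (auto simp: below_def)
          qed
          then show ?thesis using h t c by (auto simp: below_def)
        qed
        then have "ennreal (L (\<lambda>x. trunc \<epsilon> f x + h x)) \<le> content V" by (rule content_upper)
        moreover have "0 \<le> L (trunc \<epsilon> f)" "0 \<le> L h"
          using t h by (auto intro!: nonneg simp: below_def)
        ultimately show ?thesis by (simp add: add[OF c] ennreal_plus)
      qed
      then show ?thesis
        unfolding content_def[of "V - K"]
        using zero_below[of "V - K"] by (subst ennreal_SUP_add_right) (auto intro!: SUP_least)
    qed
    ultimately show ?thesis by (meson add_left_mono order.trans)
  qed
  \<comment> \<open>Finiteness allows the outer measure to be moved to the other side in
    \<open>ennreal\<close>, which gives \<open>key\<close> the shape demanded by
    \<open>content_least\<close>; it is added back afterwards.\<close>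
  have fin: "outer (V - W) < \<infinity>" using V by (intro outer_finite) (auto dest: openin_subset)
  have "content (V \<inter> W) \<le> content V - outer (V - W)"
    by (rule content_least) (use key fin in \<open>simp add: ennreal_le_minus_iff add.commute\<close>)
  then have "content (V \<inter> W) + outer (V - W) \<le> content V - outer (V - W) + outer (V - W)"
    by (rule add_right_mono)
  also have "\<dots> = content V"
    using V by (intro diff_add_cancel_ennreal outer_lower) auto
  finally show ?thesis by (simp add: outer_open[OF VW])
qed

text \<open>An arbitrary test set E reduces to an open one, because \<open>outer E\<close> is an
  infimum over the open sets containing E.\<close>

lemma open_in_lambda_system:
  assumes W: "openin B W"
  shows "W \<in> lambda_system (topspace B) (Pow (topspace B)) outer"
proof -
  interpret algebra "topspace B" "Pow (topspace B)" by (rule algebra_Pow)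
  have "outer (E \<inter> W) + outer (E - W) = outer E" if E: "E \<subseteq> topspace B" for E
  proof (rule antisym)
    show "outer E \<le> outer (E \<inter> W) + outer (E - W)"
      using outer_Un[of "E \<inter> W" "E - W"] E by (simp add: Int_Diff_Un subset_iff)
    show "outer (E \<inter> W) + outer (E - W) \<le> outer E"
    proof (subst (3) outer_def, rule INF_greatest)
      fix V assume V: "V \<in> {V. openin B V \<and> E \<subseteq> V}"
      then have "outer (E \<inter> W) + outer (E - W) \<le> outer (V \<inter> W) + outer (V - W)"
        by (intro add_mono outer_mono) auto
      also have "\<dots> \<le> content V" using V W by (intro open_split) auto
      finally show "outer (E \<inter> W) + outer (E - W) \<le> content V" .
    qed
  qed
  then show ?thesis using openin_subset[OF W] by (simp add: lambda_system_eq)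
qed

section \<open>The representing measure: regularity and integrals\<close>

definition riesz :: "'b measure" where
  "riesz = measure_of (topspace B) {U. openin B U} outer"

lemma sets_riesz: "sets riesz = sets (borel_of B)"
  and space_riesz [simp]: "space riesz = topspace B"
  using openin_subset by (auto simp: riesz_def sets_borel_of intro!: sets_measure_of space_measure_of)

lemma emeasure_riesz: "A \<in> sets (borel_of B) \<Longrightarrow> emeasure riesz A = outer A"
proof -
  assume A: "A \<in> sets (borel_of B)"
  let ?\<Lambda> = "lambda_system (topspace B) (Pow (topspace B)) outer"
  interpret P: sigma_algebra "topspace B" "Pow (topspace B)" by (rule sigma_algebra_Pow)
  have ms: "measure_space (topspace B) ?\<Lambda> outer"
    by (rule P.caratheodory_lemma[OF outer_measure_space_outer])
  then have "sigma_algebra (topspace B) ?\<Lambda>" by (simp add: measure_space_def)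
  then have "sigma_sets (topspace B) {U. openin B U} \<subseteq> ?\<Lambda>"
    using open_in_lambda_system by (intro sigma_algebra.sigma_sets_subset) auto
  moreover have "sigma_algebra (topspace B) (sigma_sets (topspace B) {U. openin B U})"
    using openin_subset by (intro sigma_algebra_sigma_sets) auto
  ultimately have "measure_space (topspace B) (sigma_sets (topspace B) {U. openin B U}) outer"
    using measure_down[OF ms] by blast
  then have "positive (sets riesz) outer" "countably_additive (sets riesz) outer"
    by (auto simp: measure_space_def sets_riesz sets_borel_of)
  then show ?thesis
    using A openin_subset sets_riesz by (intro emeasure_measure_of[OF riesz_def]) auto
qed

lemma emeasure_riesz_open: "openin B V \<Longrightarrow> emeasure riesz V = content V"
  by (simp add: emeasure_riesz outer_open openin_sets_borel_of)

lemma finite_measure_riesz: "finite_measure riesz"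
  by (rule finite_measureI) (simp add: emeasure_riesz_open content_topspace)

lemma measure_riesz_space: "measure riesz (topspace B) = L (\<lambda>x. 1)"
  by (simp add: measure_def emeasure_riesz_open content_topspace one_nonneg)

text \<open>Inner regularity of A is outer regularity of its complement: if an open V is only
  slightly larger than the complement of A, then the complement of V is a compact subset of A that
  misses little of it.\<close>

lemma radon_measure_riesz: "radon_measure B riesz"
  unfolding radon_measure_def
proof (intro conjI ballI)
  interpret finite_measure riesz by (rule finite_measure_riesz)
  fix A assume A: "A \<in> sets riesz"
  then have AX: "A \<subseteq> topspace B" using sets.sets_into_space by fastforce
  have KS: "K \<in> sets riesz" if "compactin B K" for K
    using compactin_imp_closedin[OF Hausdorff that] by (simp add: sets_riesz closedin_sets_borel_of)
  show "emeasure riesz A = (SUP K\<in>{K. compactin B K \<and> K \<subseteq> A}. emeasure riesz K)"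
  proof (rule antisym)
    show "(SUP K\<in>{K. compactin B K \<and> K \<subseteq> A}. emeasure riesz K) \<le> emeasure riesz A"
      using A by (intro SUP_least emeasure_mono) auto
    show "emeasure riesz A \<le> (SUP K\<in>{K. compactin B K \<and> K \<subseteq> A}. emeasure riesz K)"
    proof (rule ennreal_le_epsilon)
      fix e :: real assume e: "e > 0"
      have CA: "topspace B - A \<in> sets riesz" using sets.compl_sets[OF A] by simp
      obtain V where V: "openin B V" "topspace B - A \<subseteq> V" "content V < outer (topspace B - A) + ennreal e"
        using outer_close[of "topspace B - A" e] e by auto
      have Vs: "V \<in> sets riesz" using V(1) by (simp add: sets_riesz openin_sets_borel_of)
      define K where "K = topspace B - V"
      have K: "compactin B K" "K \<subseteq> A"
        using V by (auto simp: K_def intro!: closedin_compact_space[OF compact])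
      have "emeasure riesz V = emeasure riesz (topspace B - A) + emeasure riesz (V - (topspace B - A))"
        using V(2) CA Vs by (subst plus_emeasure) (auto simp: Un_absorb1)
      moreover have "emeasure riesz V \<le> emeasure riesz (topspace B - A) + ennreal e"
        using V(1,3) CA by (simp add: emeasure_riesz_open emeasure_riesz sets_riesz)
      ultimately have d: "emeasure riesz (V - (topspace B - A)) \<le> ennreal e"
        using e by (simp add: emeasure_eq_measure flip: ennreal_plus)
      have "A = K \<union> (V - (topspace B - A))" using AX K(2) openin_subset[OF V(1)] by (auto simp: K_def)
      then have "emeasure riesz A \<le> emeasure riesz K + emeasure riesz (V - (topspace B - A))"
        using emeasure_subadditive[OF KS[OF K(1)], of "V - (topspace B - A)"] Vs CA by auto
      also have "\<dots> \<le> (SUP K\<in>{K. compactin B K \<and> K \<subseteq> A}. emeasure riesz K) + ennreal e"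
        using K d by (intro add_mono SUP_upper) auto
      finally show "emeasure riesz A \<le> (SUP K\<in>{K. compactin B K \<and> K \<subseteq> A}. emeasure riesz K) + ennreal e" .
    qed
  qed
qed (simp_all add: sets_riesz finite_measure_riesz)

text \<open>Layer cake: \<open>n f\<close> is, up to an error of one, the sum of the indicators of \<open>{f > i/n}\<close>.\<close>

lemma L_le_integral_unit:
  assumes f: "f \<in> cont_funs B" and f01: "\<And>x. x \<in> topspace B \<Longrightarrow> 0 \<le> f x \<and> f x \<le> 1"
  shows "L f \<le> integral\<^sup>L riesz f"
proof -
  interpret finite_measure riesz by (rule finite_measure_riesz)
  have bound: "L f \<le> integral\<^sup>L riesz f + L (\<lambda>x. 1) / real (Suc m)" for m
  proof -
    define n where "n = real (Suc m)"
    have n: "n > 0" by (simp add: n_def)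
    define V where "V i = {x \<in> topspace B. real i / n < f x}" for i
    \<comment> \<open>The slice of f between heights i/n and (i+1)/n. The slices telescope to f, and
      n times a slice competes for the content of \<open>V i\<close>.\<close>
    define g where "g i x = min (f x) (real (Suc i) / n) - min (f x) (real i / n)" for i x
    have V: "openin B (V i)" for i unfolding V_def by (rule openin_cont_funs_greater[OF f])
    then have Vs: "V i \<in> sets riesz" for i by (simp add: sets_riesz openin_sets_borel_of)
    have g: "g i \<in> cont_funs B" for i
      unfolding g_def by (intro cont_funs_diff cont_funs_min f cont_funs_const)
    have step: "real (Suc i) / n = real i / n + 1 / n" for i by (simp add: add_divide_distrib)
    have n': "0 < 1 / n" using n by simp
    have g_nonneg: "0 \<le> g i x" and g_le: "g i x \<le> 1 / n" for i x
      unfolding g_def step using n' by linarith+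
    have g_ge: "indicator (V (Suc i)) x / n \<le> g i x" if "x \<in> topspace B" for i x
    proof (cases "x \<in> V (Suc i)")
      case True
      then have "real i / n + 1 / n < f x" unfolding V_def step by simp
      then have "g i x = 1 / n" unfolding g_def step using n' by linarith
      then show ?thesis using True by simp
    qed (simp add: g_nonneg)
    have g_zero: "g i x = 0" if "x \<in> topspace B - V i" for i x
    proof -
      have "f x \<le> real i / n" using that by (auto simp: V_def)
      then show ?thesis unfolding g_def step using n' by linarith
    qed
    have "n * g i x \<le> 1" for i x using g_le[of i x] n by (simp add: field_simps)
    then have "(\<lambda>x. n * g i x) \<in> below (V i)" for i
      using n g_nonneg g_zero fun_subspace_scale[OF fun_subspace_cont_funs g]
      by (simp add: below_def)
    then have "ennreal (L (\<lambda>x. n * g i x)) \<le> emeasure riesz (V i)" for i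
      using content_upper emeasure_riesz_open[OF V] by metis
    then have "n * L (g i) \<le> measure riesz (V i)" for i
      using scale[OF g] by (simp add: emeasure_eq_measure)
    then have Lg: "L (g i) \<le> measure riesz (V i) / n" for i
      using n by (simp add: field_simps)
    have tele: "(\<Sum>i<Suc m. g i x) = f x" if "x \<in> topspace B" for x
      using f01[OF that] n unfolding g_def
      by (subst sum_lessThan_telescope) (simp add: n_def)
    have "L f \<le> L (\<lambda>x. \<Sum>i<Suc m. g i x)"
      using tele by (intro mono f cont_funs_sum g) simp
    also have "\<dots> = (\<Sum>i<Suc m. L (g i))" by (rule sum[OF g])
    also have "\<dots> \<le> (\<Sum>i<Suc m. measure riesz (V i) / n)" by (intro sum_mono Lg)
    also have "\<dots> = (\<integral>x. (\<Sum>i<Suc m. indicator (V i) x / n) \<partial>riesz)"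
    proof (subst Bochner_Integration.integral_sum)
      show "integrable riesz (\<lambda>x. indicator (V i) x / n)" for i
        using Vs[of i] by (intro integrable_divide_zero) (simp add: emeasure_eq_measure)
      have "V i \<inter> topspace B = V i" for i by (auto simp: V_def)
      then show "(\<Sum>i<Suc m. measure riesz (V i) / n) = (\<Sum>i<Suc m. \<integral>x. indicator (V i) x / n \<partial>riesz)"
        by simp
    qed
    also have "\<dots> \<le> (\<integral>x. f x + 1 / n \<partial>riesz)"
    proof (rule integral_mono)
      show "integrable riesz (\<lambda>x. \<Sum>i<Suc m. indicator (V i) x / n)"
        using Vs by (intro Bochner_Integration.integrable_sum integrable_divide_zero) (simp add: emeasure_eq_measure)
      show "integrable riesz (\<lambda>x. f x + 1 / n)"
        by (intro cont_funs_integrable[OF compact _ finite_measure_riesz sets_riesz]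
            cont_funs_add f cont_funs_const)
    next
      fix x assume "x \<in> space riesz"
      then have x: "x \<in> topspace B" by simp
      \<comment> \<open>The shift by one reverses the comparison: a slice reaches its full height
        1/n on \<open>V (Suc i)\<close>, so only the indicator of \<open>V 0\<close> is left over,
        at a cost of 1/n.\<close>
      have "(\<Sum>i<Suc m. indicator (V i) x / n) = indicator (V 0) x / n + (\<Sum>i<m. indicator (V (Suc i)) x / n)"
        by (rule sum.lessThan_Suc_shift)
      also have "\<dots> \<le> 1 / n + (\<Sum>i<m. g i x)"
        using n by (intro add_mono sum_mono g_ge x divide_right_mono indicator_le_1) auto
      also have "\<dots> \<le> 1 / n + (\<Sum>i<Suc m. g i x)" using g_nonneg by simp
      finally show "(\<Sum>i<Suc m. indicator (V i) x / n) \<le> f x + 1 / n"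
        using tele[OF x] by simp
    qed
    also have "\<dots> = integral\<^sup>L riesz f + L (\<lambda>x. 1) / n"
      using cont_funs_integrable[OF compact f finite_measure_riesz sets_riesz]
      by (simp add: measure_riesz_space)
    finally show ?thesis by (simp add: n_def)
  qed
  have "(\<lambda>m. integral\<^sup>L riesz f + L (\<lambda>x. 1) * inverse (real (Suc m))) \<longlonglongrightarrow> integral\<^sup>L riesz f + L (\<lambda>x. 1) * 0"
    by (intro tendsto_intros LIMSEQ_inverse_real_of_nat)
  then have "L f \<le> integral\<^sup>L riesz f + L (\<lambda>x. 1) * 0"
    by (rule LIMSEQ_le_const) (use bound in \<open>auto simp: divide_inverse\<close>)
  then show ?thesis by simp
qed

text \<open>The affine change (f + b)/(2b) brings the values into [0,1]. It is compatible with both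
  sides because \<open>riesz\<close> has total mass L(1).\<close>

lemma L_le_integral:
  assumes f: "f \<in> cont_funs B"
  shows "L f \<le> integral\<^sup>L riesz f"
proof -
  obtain b where b: "b > 0" "\<And>x. x \<in> topspace B \<Longrightarrow> \<bar>f x\<bar> \<le> b"
    using cont_funs_bounded[OF compact f] by blast
  have fb: "(\<lambda>x. f x + b) \<in> cont_funs B" by (intro cont_funs_add f cont_funs_const)
  have int: "integrable riesz f" by (rule cont_funs_integrable[OF compact f finite_measure_riesz sets_riesz])
  interpret finite_measure riesz by (rule finite_measure_riesz)
  have "L (\<lambda>x. 1 / (2 * b) * (f x + b)) \<le> integral\<^sup>L riesz (\<lambda>x. 1 / (2 * b) * (f x + b))"
  proof (rule L_le_integral_unit)
    show "(\<lambda>x. 1 / (2 * b) * (f x + b)) \<in> cont_funs B"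
      by (rule fun_subspace_scale[OF fun_subspace_cont_funs fb])
    fix x assume "x \<in> topspace B"
    from b(2)[OF this] show "0 \<le> 1 / (2 * b) * (f x + b) \<and> 1 / (2 * b) * (f x + b) \<le> 1"
      using b(1) by (simp add: field_simps abs_le_iff)
  qed
  then have "1 / (2 * b) * (L f + b * L (\<lambda>x. 1)) \<le> 1 / (2 * b) * (integral\<^sup>L riesz f + b * L (\<lambda>x. 1))"
    unfolding scale[OF fb] add[OF f cont_funs_const] const[of b]
    using int by (simp add: measure_riesz_space mult.commute)
  moreover have "1 / (2 * b) > 0" using b(1) by simp
  ultimately have "L f + b * L (\<lambda>x. 1) \<le> integral\<^sup>L riesz f + b * L (\<lambda>x. 1)"
    by (rule mult_left_le_imp_le)
  then show ?thesis by simp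
qed

text \<open>The one-sided bound suffices: applied to -f it becomes the reverse inequality.\<close>

theorem integral_riesz:
  assumes f: "f \<in> cont_funs B"
  shows "integral\<^sup>L riesz f = L f"
proof (rule antisym)
  have "L (\<lambda>x. - f x) = - L f" using scale[OF f, of "-1"] by simp
  then show "integral\<^sup>L riesz f \<le> L f" using L_le_integral[OF cont_funs_uminus[OF f]] by simp
qed (rule L_le_integral[OF f])

end

section \<open>Minimal measures\<close>

locale compactified_pairs =
  fixes B :: "'b topology" and e :: "'a::complete_space \<times> 'a \<Rightarrow> 'b"
    and U :: "'u topology" and i :: "'a \<Rightarrow> 'u" and p1 p2 :: "'b \<Rightarrow> 'u"
  assumes three: "\<exists>a b c :: 'a. a \<noteq> b \<and> b \<noteq> c \<and> a \<noteq> c"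
    and SC: "stone_cech_compactification (subtopology euclidean {(x, y). x \<noteq> y}) B e"
    and UC: "uniform_compactification U i"
    and p1: "continuous_map B U p1" "\<And>x y. x \<noteq> y \<Longrightarrow> p1 (e (x, y)) = i x"
    and p2: "continuous_map B U p2" "\<And>x y. x \<noteq> y \<Longrightarrow> p2 (e (x, y)) = i y"
begin

section \<open>Passing between points of the compactifications and pairs of points\<close>

abbreviation (input) offdiag :: "('a \<times> 'a) set" where
  "offdiag \<equiv> {(x, y). x \<noteq> y}"

lemma compact_B: "compact_space B" and Hausdorff_B: "Hausdorff_space B"
  using SC by (auto simp: stone_cech_compactification_def)

lemma compact_U: "compact_space U" and Hausdorff_U: "Hausdorff_space U"
  using UC by (auto simp: uniform_compactification_def)

lemma e_in_B:
  assumes "x \<noteq> y"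
  shows "e (x, y) \<in> topspace B"
proof -
  have "homeomorphic_map (subtopology euclidean offdiag) (subtopology B (e ` offdiag)) e"
    using SC by (simp add: stone_cech_compactification_def embedding_map_def)
  from homeomorphic_imp_surjective_map[OF this] have "e ` offdiag = topspace B \<inter> e ` offdiag"
    unfolding topspace_subtopology topspace_euclidean Int_UNIV_left .
  then show ?thesis using assms by blast
qed

text \<open>Density is how the metric arguments reach actual points: the conditions at \<zeta> are
  collected in an open set, and a genuine pair in that set satisfies all of them.\<close>

lemma pair_in_open:
  assumes "openin B A" "\<zeta> \<in> A"
  obtains x y where "x \<noteq> y" "e (x, y) \<in> A"
proof -
  have "\<zeta> \<in> B closure_of (e ` topspace (subtopology euclidean offdiag))"
    using SC assms openin_subset by (auto simp: stone_cech_compactification_def)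
  then show ?thesis using assms that unfolding in_closure_of by auto
qed

lemma extend_offdiag:
  assumes "continuous_on offdiag f" "bounded (f ` offdiag)"
  obtains F where "F \<in> cont_funs B" "\<And>x y. x \<noteq> y \<Longrightarrow> F (e (x, y)) = (f (x, y) :: real)"
proof -
  have "continuous_map (subtopology euclidean offdiag) euclideanreal f"
    "bounded (f ` topspace (subtopology euclidean offdiag))"
    using assms by simp_all
  then obtain F where "continuous_map B euclideanreal F"
      "\<forall>z\<in>topspace (subtopology euclidean offdiag). F (e z) = f z"
    using SC unfolding stone_cech_compactification_def by blast
  then show ?thesis using that[of F] by (simp add: cont_funs_def)
qed

lemma extend_uniform:
  assumes "bounded (range f)" "uniformly_continuous_on UNIV f"
  obtains F where "continuous_map U euclideanreal F" "\<And>x. F (i x) = (f x :: real)"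
  using UC assms unfolding uniform_compactification_def by metis

lemma restrict_uniform:
  assumes "continuous_map U euclideanreal F"
  shows "uniformly_continuous_on UNIV (\<lambda>x. F (i x))"
  using UC assms unfolding uniform_compactification_def by blast

lemma cont_funs_p1: "continuous_map U euclideanreal F \<Longrightarrow> (\<lambda>x. F (p1 x)) \<in> cont_funs B"
  and cont_funs_p2: "continuous_map U euclideanreal F \<Longrightarrow> (\<lambda>x. F (p2 x)) \<in> cont_funs B"
  using continuous_map_compose[OF p1(1), of euclideanreal F]
    continuous_map_compose[OF p2(1), of euclideanreal F]
  by (simp_all add: cont_funs_def o_def)

text \<open>In the Samuel compactification, two sets at positive distance have disjoint closures.\<close>

lemma near_pairs:
  assumes A: "openin B A" "\<zeta> \<in> A" and A': "openin B A'" "\<zeta>' \<in> A'"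
    and eq: "p2 \<zeta> = p1 \<zeta>'" and \<delta>: "\<delta> > 0"
  obtains x u u' y where "x \<noteq> u" "e (x, u) \<in> A" "u' \<noteq> y" "e (u', y) \<in> A'" "dist u u' < \<delta>"
proof (rule ccontr)
  assume none: "\<not> thesis"
  define S where "S = {u. \<exists>x. x \<noteq> u \<and> e (x, u) \<in> A}"
  have S0: "S \<noteq> {}" using pair_in_open[OF A] by (metis (mono_tags, lifting) S_def empty_iff mem_Collect_eq)
  define f where "f z = min (infdist z S) \<delta>" for z
  have f: "bounded (range f)" "uniformly_continuous_on UNIV f"
  \<comment> \<open>A bounded 1-Lipschitz function extends to \<open>U\<close>. The extension is at
    most 0 at p2 \<zeta>, since f vanishes on second coordinates of pairs in A; if no u' came within
    \<delta> of S, it would be at least \<delta> at p1 \<zeta>'.\<close>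
  proof -
    show "bounded (range f)"
      using \<delta> infdist_nonneg[of _ S] by (intro boundedI[of _ \<delta>]) (auto simp: f_def)
    have "dist (f z) (f w) \<le> dist z w" for z w
      using infdist_triangle_abs[of z S w] by (auto simp: f_def dist_real_def)
    then show "uniformly_continuous_on UNIV f"
      unfolding uniformly_continuous_on_def by (meson le_less_trans)
  qed
  from extend_uniform[OF f] obtain F where F: "continuous_map U euclideanreal F" "\<And>x. F (i x) = f x"
    by blast
  have "F (p2 \<zeta>) \<le> 0"
  proof (rule ccontr)
    assume "\<not> F (p2 \<zeta>) \<le> 0"
    then have mem: "\<zeta> \<in> A \<inter> {\<xi> \<in> topspace B. 0 < F (p2 \<xi>)}"
      using A openin_subset by auto
    have "openin B (A \<inter> {\<xi> \<in> topspace B. 0 < F (p2 \<xi>)})"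
      by (intro openin_Int A openin_cont_funs_greater cont_funs_p2 F)
    from pair_in_open[OF this mem] obtain x u where
      "x \<noteq> u" "e (x, u) \<in> A \<inter> {\<xi> \<in> topspace B. 0 < F (p2 \<xi>)}" .
    then have "u \<in> S" "0 < f u" using p2(2) F(2) by (auto simp: S_def)
    then show False using \<delta> by (simp add: f_def)
  qed
  moreover have "\<delta> \<le> F (p1 \<zeta>')"
  proof (rule ccontr)
    assume "\<not> \<delta> \<le> F (p1 \<zeta>')"
    then have mem: "\<zeta>' \<in> A' \<inter> {\<xi> \<in> topspace B. F (p1 \<xi>) < \<delta>}"
      using A' openin_subset by auto
    have "openin B (A' \<inter> {\<xi> \<in> topspace B. F (p1 \<xi>) < \<delta>})"
      by (intro openin_Int A' openin_cont_funs_less cont_funs_p1 F)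
    from pair_in_open[OF this mem] obtain u' y where
      uy: "u' \<noteq> y" "e (u', y) \<in> A' \<inter> {\<xi> \<in> topspace B. F (p1 \<xi>) < \<delta>}" .
    then have "min (infdist u' S) \<delta> < \<delta>" using p1(2) F(2) by (simp add: f_def)
    then have "infdist u' S < \<delta>" by linarith
    then obtain u where "u \<in> S" "dist u' u < \<delta>"
      using S0 infdist_notempty[of S u'] cINF_less_iff[of S "dist u'" \<delta>] by auto
    then obtain x where "x \<noteq> u" "e (x, u) \<in> A" "dist u u' < \<delta>" by (auto simp: S_def dist_commute)
    then show False using none that[of x u u' y] uy by blast
  qed
  ultimately show False using eq \<delta> by simp
qed

text \<open>A continuous F on \<open>U\<close> separating the two projections is uniformly
  continuous on the metric space. Near \<zeta> the values of F at the two coordinates differ by more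
  than 1/2, so these coordinates stay at least \<delta> apart and r cannot reach 1.\<close>

lemma distance_pos:
  assumes r: "r \<in> cont_funs B" "\<And>x y. x \<noteq> y \<Longrightarrow> r (e (x, y)) = 1 / (1 + dist x y)"
    and \<zeta>: "\<zeta> \<in> topspace B" "p1 \<zeta> \<noteq> p2 \<zeta>"
  shows "r \<zeta> < 1"
proof (rule ccontr)
  assume r1: "\<not> r \<zeta> < 1"
  have "p1 \<zeta> \<in> topspace U" "p2 \<zeta> \<in> topspace U"
    using \<zeta> p1(1) p2(1) by (auto simp: continuous_map_def)
  then have cl: "closedin U {p1 \<zeta>}" "closedin U {p2 \<zeta>}"
    using Hausdorff_U by (auto intro: closedin_Hausdorff_singleton)
  have disj: "disjnt {p1 \<zeta>} {p2 \<zeta>}" using \<zeta> by simp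
  have "normal_space U"
    using compact_Hausdorff_or_regular_imp_normal_space[OF compact_U] Hausdorff_U by blast
  from Urysohn_lemma_alt[OF this cl disj, of 0 1] obtain F where
    F: "continuous_map U euclideanreal F" "F (p1 \<zeta>) = 0" "F (p2 \<zeta>) = 1"
    by auto
  obtain \<delta> where \<delta>: "\<delta> > 0" "\<And>x y. dist x y < \<delta> \<Longrightarrow> dist (F (i x)) (F (i y)) < 1/2"
    using restrict_uniform[OF F(1)] unfolding uniformly_continuous_on_def
    by (metis UNIV_I half_gt_zero_iff zero_less_one)
  let ?A = "{\<xi> \<in> topspace B. 1 / (1 + \<delta>) < r \<xi>} \<inter> {\<xi> \<in> topspace B. 1/2 < F (p2 \<xi>) - F (p1 \<xi>)}"
  have op: "openin B ?A"
    by (intro openin_Int openin_cont_funs_greater cont_funs_diff cont_funs_p1 cont_funs_p2 F r)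
  have "1 / (1 + \<delta>) < 1" using \<delta> by simp
  then have "\<zeta> \<in> ?A" using \<zeta> F r1 by auto
  from pair_in_open[OF op this] obtain x y where xy: "x \<noteq> y" "e (x, y) \<in> ?A" .
  then have "1 / (1 + \<delta>) < 1 / (1 + dist x y)" using r(2) by auto
  then have "dist x y < \<delta>"
    using \<delta>(1) by (simp add: field_simps add_pos_nonneg)
  then show False using \<delta>(2)[of x y] xy p1(2) p2(2) by (auto simp: dist_real_def)
qed

text \<open>Near \<zeta> both coordinates lie within some N of the base point, so their distance is
  below 2N and r cannot drop below 1/(1+2N).\<close>

lemma distance_finite:
  assumes r: "r \<in> cont_funs B" "\<And>x y. x \<noteq> y \<Longrightarrow> r (e (x, y)) = 1 / (1 + dist x y)"
    and d: "continuous_map U euclidean d" "\<And>x. d (i x) = ennreal (dist x z)"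
    and \<zeta>: "\<zeta> \<in> topspace B" "d (p1 \<zeta>) < \<infinity>" "d (p2 \<zeta>) < \<infinity>"
  shows "0 < r \<zeta>"
proof (rule ccontr)
  assume r0: "\<not> 0 < r \<zeta>"
  obtain N :: nat where N: "d (p1 \<zeta>) < of_nat N" "d (p2 \<zeta>) < of_nat N"
  proof -
    obtain n m where "d (p1 \<zeta>) < of_nat n" "d (p2 \<zeta>) < of_nat m"
      using \<zeta> ennreal_Ex_less_of_nat by (metis infinity_ennreal_def)
    then show ?thesis using that[of "max n m"]
      by (metis max.cobounded1 max.cobounded2 of_nat_mono order_less_le_trans)
  qed
  have opd: "openin B {\<xi> \<in> topspace B. d (p \<xi>) < of_nat N}" if "continuous_map B U p" for p
    using continuous_map_compose[OF that d(1)] unfolding continuous_map_def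
    by (auto dest!: spec[of _ "{..<of_nat N}"])
  let ?A = "({\<xi> \<in> topspace B. d (p1 \<xi>) < of_nat N} \<inter> {\<xi> \<in> topspace B. d (p2 \<xi>) < of_nat N})
    \<inter> {\<xi> \<in> topspace B. r \<xi> < 1 / (1 + 2 * real N)}"
  have op: "openin B ?A" by (intro openin_Int opd p1 p2 openin_cont_funs_less r)
  have "0 < 1 / (1 + 2 * real N)" by simp
  then have "r \<zeta> < 1 / (1 + 2 * real N)" using r0 by linarith
  then have "\<zeta> \<in> ?A" using \<zeta> N by auto
  from pair_in_open[OF op this] obtain x y where xy: "x \<noteq> y" "e (x, y) \<in> ?A" .
  then have "ennreal (dist x z) < ennreal (real N)" "ennreal (dist y z) < ennreal (real N)"
    using p1(2) p2(2) d(2) by (auto simp: ennreal_of_nat_eq_real_of_nat)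
  then have "dist x z < real N" "dist y z < real N" by (auto simp: ennreal_less_iff)
  then have "dist x y < 2 * real N" using dist_triangle2[of x y z] by linarith
  moreover have "1 / (1 + dist x y) < 1 / (1 + 2 * real N)" using xy r(2) by auto
  ultimately show False by (simp add: field_simps add_pos_nonneg)
qed

section \<open>The convex cone G and its triangle inequality\<close>

lemma G_set_cont: "g \<in> G_set B e \<Longrightarrow> g \<in> cont_funs B"
  by (simp add: G_set_def cont_funs_def)

lemma G_set_add:
  assumes "g \<in> G_set B e" "h \<in> G_set B e"
  shows "(\<lambda>x. g x + h x) \<in> G_set B e"
proof -
  have "dist x y * (g (e (x, y)) + h (e (x, y)))
      \<le> dist x u * (g (e (x, u)) + h (e (x, u))) + dist u y * (g (e (u, y)) + h (e (u, y)))"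
    if "x \<noteq> u" "u \<noteq> y" "x \<noteq> y" for x u y
  proof -
    have "dist x y * f (e (x, y)) \<le> dist x u * f (e (x, u)) + dist u y * f (e (u, y))"
      if "f \<in> {g, h}" for f using that assms \<open>x \<noteq> u\<close> \<open>u \<noteq> y\<close> \<open>x \<noteq> y\<close> by (auto simp: G_set_def)
    from this[of g] this[of h] show ?thesis by (simp add: distrib_left)
  qed
  then show ?thesis using assms by (auto simp: G_set_def intro: continuous_map_add)
qed

lemma G_set_scale:
  assumes "g \<in> G_set B e" "c \<ge> 0"
  shows "(\<lambda>x. c * g x) \<in> G_set B e"
proof -
  have "dist x y * (c * g (e (x, y))) \<le> dist x u * (c * g (e (x, u))) + dist u y * (c * g (e (u, y)))"
    if "x \<noteq> u" "u \<noteq> y" "x \<noteq> y" for x u y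
  proof -
    have "c * (dist x y * g (e (x, y))) \<le> c * (dist x u * g (e (x, u)) + dist u y * g (e (u, y)))"
      using assms that by (intro mult_left_mono) (auto simp: G_set_def)
    then show ?thesis by (simp add: algebra_simps)
  qed
  then show ?thesis using assms by (auto simp: G_set_def intro: continuous_map_real_mult_left)
qed

lemma G_set_const: "c \<ge> 0 \<Longrightarrow> (\<lambda>x. c) \<in> G_set B e"
  using mult_right_mono[OF dist_triangle] by (auto simp: G_set_def distrib_right)

text \<open>With a third point v, add the inequalities for going from u to v through x and from x to
  v through u: the terms ending in v cancel.\<close>

lemma G_set_nonneg_sum:
  assumes g: "g \<in> G_set B e" and "x \<noteq> u"
  shows "0 \<le> g (e (x, u)) + g (e (u, x))"
proof -
  obtain v where v: "v \<noteq> x" "v \<noteq> u" using three by metis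
  have *: "dist a c * g (e (a, c)) \<le> dist a b * g (e (a, b)) + dist b c * g (e (b, c))"
    if "a \<noteq> b" "b \<noteq> c" "a \<noteq> c" for a b c using g that by (auto simp: G_set_def)
  have "0 \<le> dist x u * (g (e (x, u)) + g (e (u, x)))"
    using *[of u v x] *[of x v u] *[of u x v] *[of v u x] *[of v x u] *[of x u v] v assms(2)
    by (simp add: dist_commute algebra_simps)
  then show ?thesis using assms(2) by (simp add: zero_le_mult_iff)
qed

text \<open>Removes the distinctness conditions, since density gives no control over coincidences
  among the chosen points. A coincidence with u is trivial, as the factor \<open>dist\<close>
  vanishes; the case x = y is \<open>G_set_nonneg_sum\<close>.\<close>

lemma G_set_triangle:
  assumes g: "g \<in> G_set B e"
  shows "dist x y * g (e (x, y)) \<le> dist x u * g (e (x, u)) + dist u y * g (e (u, y))"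
proof -
  consider "x = u" | "u = y" | "x = y" "x \<noteq> u" | "x \<noteq> u" "u \<noteq> y" "x \<noteq> y" by blast
  then show ?thesis
  proof cases
    case 3
    have "0 \<le> dist x u * (g (e (x, u)) + g (e (u, x)))"
      using G_set_nonneg_sum[OF g 3(2)] by simp
    then show ?thesis using 3 by (simp add: dist_commute distrib_left)
  qed (use g in \<open>auto simp: G_set_def\<close>)
qed

text \<open>Dividing \<open>min d c\<close> by d gives min(1, c/d), which is bounded and continuous
  off the diagonal and so extends to \<open>B\<close>. Membership in G is the triangle inequality
  for the metric \<open>min d c\<close>.\<close>

lemma truncated_distance:
  assumes c: "c > 0"
  obtains g where "g \<in> G_set B e" "\<And>x y. x \<noteq> y \<Longrightarrow> dist x y * g (e (x, y)) = min (dist x y) c"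
proof -
  have "continuous_on offdiag (\<lambda>(x, y). min 1 (c / dist x y))"
    unfolding case_prod_beta by (intro continuous_intros) auto
  moreover have "bounded ((\<lambda>(x, y). min 1 (c / dist x y)) ` offdiag)"
    using c by (intro boundedI[of _ 1]) auto
  ultimately obtain g where g: "g \<in> cont_funs B"
      "\<And>x y. x \<noteq> y \<Longrightarrow> g (e (x, y)) = (case (x, y) of (x, y) \<Rightarrow> min 1 (c / dist x y))"
    using extend_offdiag by blast
  have eq: "dist x y * g (e (x, y)) = min (dist x y) c" if "x \<noteq> y" for x y
    using g(2)[OF that] that by (auto simp: min_def field_simps)
  have "min (dist x y) c \<le> min (dist x u) c + min (dist u y) c" for x u y
    using dist_triangle[of x y u] c zero_le_dist[of x u] zero_le_dist[of u y] by linarith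
  then have "g \<in> G_set B e" using g(1) by (auto simp: G_set_def cont_funs_def eq)
  then show ?thesis using that eq by blast
qed

text \<open>The budget for D = d k: each of the two links contributes at most -3c/4 and the gap
  between the middle points at most c/4. The total -5c/4 is below -c, whereas k + g \<ge> 0 forces D
  x y \<ge> -c.\<close>

lemma disjoint_projections:
  assumes r: "r \<in> cont_funs B" "\<And>x y. x \<noteq> y \<Longrightarrow> r (e (x, y)) = 1 / (1 + dist x y)"
    and g: "g \<in> cont_funs B" "\<And>x y. x \<noteq> y \<Longrightarrow> dist x y * g (e (x, y)) = min (dist x y) c"
    and k: "k \<in> G_set B e" "\<And>\<xi>. \<xi> \<in> topspace B \<Longrightarrow> 0 \<le> k \<xi> + g \<xi>"
    and c: "c > 0" and a: "a > 0" and s: "s \<le> a * c / 4"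
    and A: "A = {\<xi> \<in> topspace B. a < r \<xi>} \<inter> {\<xi> \<in> topspace B. r \<xi> < 1 / (1 + c)}
      \<inter> {\<xi> \<in> topspace B. k \<xi> + g \<xi> < s}"
  shows "p1 ` A \<inter> p2 ` A = {}"
proof (rule ccontr)
  assume "p1 ` A \<inter> p2 ` A \<noteq> {}"
  then obtain \<zeta> \<zeta>' where \<zeta>: "\<zeta> \<in> A" "\<zeta>' \<in> A" "p2 \<zeta> = p1 \<zeta>'" by force
  have openA: "openin B A"
    unfolding A by (intro openin_Int openin_cont_funs_greater openin_cont_funs_less cont_funs_add
        r g G_set_cont[OF k(1)])
  obtain b where b: "b > 0" "\<And>\<xi>. \<xi> \<in> topspace B \<Longrightarrow> \<bar>k \<xi>\<bar> \<le> b"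
    using cont_funs_bounded[OF compact_B G_set_cont[OF k(1)]] by blast
  \<comment> \<open>The distance c/(4b) uses the bound b on |k|, so that crossing the gap costs at
    most c/4.\<close>
  obtain x u u' y where xy: "x \<noteq> u" "e (x, u) \<in> A" "u' \<noteq> y" "e (u', y) \<in> A"
    and uu: "dist u u' < c / (4 * b)"
    using near_pairs[OF openA \<zeta>(1) openA \<zeta>(2,3), of "c / (4 * b)"] b c
    by (metis divide_pos_pos mult_pos_pos zero_less_numeral)
  define D where "D v w = dist v w * k (e (v, w))" for v w
  \<comment> \<open>On A, r < 1/(1+c) means d > c, so d g equals c; and r > a gives d \<le> 1/a, so
    the slack s \<le> a c/4 costs at most c/4 once multiplied by d.\<close>
  have link: "D v w \<le> - (3 * c / 4)" if vw: "v \<noteq> w" "e (v, w) \<in> A" for v w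
  proof -
    have 1: "a < 1 / (1 + dist v w)" "1 / (1 + dist v w) < 1 / (1 + c)" "k (e (v, w)) + g (e (v, w)) < s"
      using vw r(2) by (auto simp: A)
    have d: "c < dist v w" using 1(2) c by (simp add: field_simps add_pos_nonneg)
    have "a * (1 + dist v w) < 1" using 1(1) by (simp add: field_simps add_pos_nonneg)
    then have ad: "a * dist v w \<le> 1" using a by (simp add: algebra_simps)
    have "dist v w * (k (e (v, w)) + g (e (v, w))) \<le> dist v w * s"
      using 1(3) by (intro mult_left_mono) auto
    also have "\<dots> \<le> dist v w * (a * c / 4)" using s by (intro mult_left_mono) auto
    also have "\<dots> = (a * dist v w) * (c / 4)" by simp
    also have "\<dots> \<le> 1 * (c / 4)" using ad c by (intro mult_right_mono) auto
    finally show ?thesis using g(2)[OF vw(1)] d by (simp add: D_def distrib_left)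
  qed
  have "D u u' \<le> c / 4"
  proof (cases "u = u'")
    case False
    have "D u u' \<le> dist u u' * b" unfolding D_def
      using b(2)[OF e_in_B[OF False]] by (intro mult_left_mono) auto
    also have "\<dots> \<le> c / (4 * b) * b" using uu b(1) by (intro mult_right_mono) auto
    finally show ?thesis using b(1) by simp
  qed (use c in \<open>simp add: D_def\<close>)
  moreover have "D x y \<le> D x u + D u y" "D u y \<le> D u u' + D u' y"
    unfolding D_def by (rule G_set_triangle[OF k(1)])+
  moreover have "- c \<le> D x y"
  proof (cases "x = y")
    case False
    have "0 \<le> dist x y * (k (e (x, y)) + g (e (x, y)))"
      using k(2)[OF e_in_B[OF False]] by simp
    then show ?thesis using g(2)[OF False] by (simp add: D_def distrib_left)
  qed (use c in \<open>simp add: D_def\<close>)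
  ultimately show False using link[OF xy(1,2)] link[OF xy(3,4)] c by simp
qed

text \<open>Hahn--Banach duality: were the infimum of \<open>\<integral>(k + g)\<close> positive, a positive functional below the
  gauge \<open>p f = inf {\<integral>k. k \<in> G, k \<ge> f}\<close> and attaining it at \<open>-g\<close> would represent a measure strictly
  below \<open>\<mu>\<close>.\<close>

lemma minimal_approximation:
  assumes radon: "radon_measure B \<mu>" and minimal: "preceq_minimal B e \<mu>"
    and g: "g \<in> G_set B e" and \<epsilon>: "\<epsilon> > 0"
  obtains k where "k \<in> G_set B e" "\<And>\<xi>. \<xi> \<in> topspace B \<Longrightarrow> 0 \<le> k \<xi> + g \<xi>"
    "(\<integral>\<xi>. k \<xi> + g \<xi> \<partial>\<mu>) < \<epsilon>"
proof -
  have sets: "sets \<mu> = sets (borel_of B)" and space: "space \<mu> = topspace B" and fin: "finite_measure \<mu>"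
    using radon by (auto simp: radon_measure_def)
  interpret finite_measure \<mu> by (rule fin)
  have int: "integrable \<mu> f" if "f \<in> cont_funs B" for f
    by (rule cont_funs_integrable[OF compact_B that fin sets])
  define M where "M f = {k \<in> G_set B e. \<forall>\<xi>\<in>topspace B. f \<xi> \<le> k \<xi>}" for f
  define p where "p f = (INF k\<in>M f. integral\<^sup>L \<mu> k)" for f
  have MG: "k \<in> G_set B e" "k \<in> cont_funs B" "\<And>\<xi>. \<xi> \<in> topspace B \<Longrightarrow> f \<xi> \<le> k \<xi>" if "k \<in> M f" for f k
    using that by (auto simp: M_def G_set_cont)
  have ne: "M f \<noteq> {}" and bdd: "bdd_below (integral\<^sup>L \<mu> ` M f)" if f: "f \<in> cont_funs B" for f
  proof -
    obtain b where b: "b > 0" "\<And>\<xi>. \<xi> \<in> topspace B \<Longrightarrow> \<bar>f \<xi>\<bar> \<le> b"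
      using cont_funs_bounded[OF compact_B f] by blast
    have "f \<xi> \<le> b" if "\<xi> \<in> topspace B" for \<xi> using b(2)[OF that] by linarith
    then have "(\<lambda>\<xi>. b) \<in> M f" using G_set_const[of b] b(1) by (auto simp: M_def)
    then show "M f \<noteq> {}" by blast
    show "bdd_below (integral\<^sup>L \<mu> ` M f)"
    proof (rule bdd_belowI2)
      fix k assume "k \<in> M f"
      then show "integral\<^sup>L \<mu> f \<le> integral\<^sup>L \<mu> k"
        using MG[of k f] by (intro integral_mono int f) (auto simp: space)
    qed
  qed
  have le: "p f \<le> integral\<^sup>L \<mu> k" if "f \<in> cont_funs B" "k \<in> M f" for f k
    unfolding p_def by (rule cINF_lower[OF bdd[OF that(1)] that(2)])
  have close: "\<exists>k\<in>M f. integral\<^sup>L \<mu> k < p f + \<delta>" if "f \<in> cont_funs B" "\<delta> > 0" for f \<delta>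
  proof -
    have "(INF k\<in>M f. integral\<^sup>L \<mu> k) < p f + \<delta>" using that by (simp add: p_def)
    then show ?thesis using cINF_less_iff[OF ne[OF that(1)] bdd[OF that(1)]] by blast
  qed
  have p: "sublinear_on (cont_funs B) p"
    unfolding sublinear_on_def
  proof (intro conjI ballI allI impI)
    fix f h assume f: "f \<in> cont_funs B" and h: "h \<in> cont_funs B"
    show "p (\<lambda>x. f x + h x) \<le> p f + p h"
    proof (rule field_le_epsilon)
      fix \<delta> :: real assume \<delta>: "\<delta> > 0"
      obtain k where k: "k \<in> M f" "integral\<^sup>L \<mu> k < p f + \<delta>/2" using close[OF f, of "\<delta>/2"] \<delta> by auto
      obtain l where l: "l \<in> M h" "integral\<^sup>L \<mu> l < p h + \<delta>/2" using close[OF h, of "\<delta>/2"] \<delta> by auto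
      have "(\<lambda>x. k x + l x) \<in> M (\<lambda>x. f x + h x)"
        using k(1) l(1) by (auto simp: M_def intro: G_set_add add_mono)
      from le[OF cont_funs_add[OF f h] this]
      have "p (\<lambda>x. f x + h x) \<le> integral\<^sup>L \<mu> k + integral\<^sup>L \<mu> l"
        using int MG(2)[OF k(1)] MG(2)[OF l(1)] by simp
      then show "p (\<lambda>x. f x + h x) \<le> p f + p h + \<delta>" using k l by linarith
    qed
  next
    fix f and c :: real assume f: "f \<in> cont_funs B" and c: "c > 0"
    show "p (\<lambda>x. c * f x) \<le> c * p f"
    proof (rule field_le_epsilon)
      fix \<delta> :: real assume \<delta>: "\<delta> > 0"
      obtain k where k: "k \<in> M f" "integral\<^sup>L \<mu> k < p f + \<delta>/c" using close[OF f, of "\<delta>/c"] \<delta> c by auto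
      have "(\<lambda>x. c * k x) \<in> M (\<lambda>x. c * f x)"
        using k(1) c by (auto simp: M_def intro: G_set_scale)
      from le[OF fun_subspace_scale[OF fun_subspace_cont_funs f] this]
      have "p (\<lambda>x. c * f x) \<le> c * integral\<^sup>L \<mu> k" by simp
      also have "\<dots> \<le> c * p f + \<delta>" using k(2) c by (simp add: field_simps)
      finally show "p (\<lambda>x. c * f x) \<le> c * p f + \<delta>" .
    qed
  qed
  have gc: "g \<in> cont_funs B" by (rule G_set_cont[OF g])
  note ngc = cont_funs_uminus[OF gc]
  obtain L where L: "\<And>f h. f \<in> cont_funs B \<Longrightarrow> h \<in> cont_funs B \<Longrightarrow> L (\<lambda>x. f x + h x) = L f + L h"
    "\<And>f c. f \<in> cont_funs B \<Longrightarrow> L (\<lambda>x. c * f x) = c * L f"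
    "\<And>f. f \<in> cont_funs B \<Longrightarrow> L f \<le> p f" "L (\<lambda>x. - g x) = p (\<lambda>x. - g x)"
    using hahn_banach_functions[OF fun_subspace_cont_funs p ngc] by blast
  interpret L: positive_functional B L
  proof
    fix f assume f: "f \<in> cont_funs B" "\<And>x. x \<in> topspace B \<Longrightarrow> 0 \<le> f x"
    \<comment> \<open>Positivity comes from the gauge: for f \<ge> 0 the zero function is a majorant
      of -f in G, hence L(-f) \<le> p(-f) \<le> 0.\<close>
    have "(\<lambda>x. 0) \<in> M (\<lambda>x. - f x)" using f(2) G_set_const[of 0] by (auto simp: M_def)
    from le[OF cont_funs_uminus[OF f(1)] this] have "L (\<lambda>x. - f x) \<le> 0"
      using L(3)[OF cont_funs_uminus[OF f(1)]] by simp
    then show "0 \<le> L f" using L(2)[OF f(1), of "-1"] by simp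
  qed (use compact_B Hausdorff_B L in auto)
  \<comment> \<open>Each k in G is a majorant of itself, so L k \<le> p k \<le> \<integral>k
    d\<mu>.\<close>
  have "preceq_meas B e L.riesz \<mu>"
    unfolding preceq_meas_def
  proof
    fix k assume k: "k \<in> G_set B e"
    then have "p k \<le> integral\<^sup>L \<mu> k" by (intro le) (auto simp: M_def G_set_cont)
    then show "integral\<^sup>L L.riesz k \<le> integral\<^sup>L \<mu> k"
      using L(3)[OF G_set_cont[OF k]] L.integral_riesz[OF G_set_cont[OF k]] by simp
  qed
  then have "preceq_meas B e \<mu> L.riesz"
    using minimal L.radon_measure_riesz by (auto simp: preceq_minimal_def)
  \<comment> \<open>Minimality reverses the comparison at g. Together with L(-g) = p(-g) it shows
    that the infimum of \<integral>(k + g) d\<mu> over admissible k is at most 0.\<close>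
  then have "integral\<^sup>L \<mu> g \<le> L g"
    using g L.integral_riesz[OF gc] by (auto simp: preceq_meas_def)
  moreover have "L (\<lambda>x. - g x) = - L g" using L(2)[OF gc, of "-1"] by simp
  ultimately have pg: "p (\<lambda>x. - g x) \<le> - integral\<^sup>L \<mu> g" using L(4) by simp
  obtain k where k: "k \<in> M (\<lambda>x. - g x)" "integral\<^sup>L \<mu> k < p (\<lambda>x. - g x) + \<epsilon>"
    using close[OF ngc \<epsilon>] by blast
  show ?thesis
  proof (rule that[of k])
    show "k \<in> G_set B e" by (rule MG(1)[OF k(1)])
    show "0 \<le> k \<xi> + g \<xi>" if "\<xi> \<in> topspace B" for \<xi> using MG(3)[OF k(1) that] by linarith
    show "(\<integral>\<xi>. k \<xi> + g \<xi> \<partial>\<mu>) < \<epsilon>"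
      using k(2) pg int[OF gc] int[OF MG(2)[OF k(1)]] by simp
  qed
qed

text \<open>The mass \<eta> is spent in thirds: on pairs that are too close or too far apart, on the
  set where k + g is not small, and on the passage to a compact subset.\<close>

lemma compact_with_disjoint_projections:
  fixes d :: "'u \<Rightarrow> ennreal"
  assumes radon: "radon_measure B \<mu>" and minimal: "preceq_minimal B e \<mu>"
    and d: "continuous_map U euclidean d" "\<And>x. d (i x) = ennreal (dist x z)"
    and conc: "AE \<zeta> in \<mu>. d (p1 \<zeta>) < \<infinity> \<and> d (p2 \<zeta>) < \<infinity> \<and> p1 \<zeta> \<noteq> p2 \<zeta>"
    and \<eta>: "\<eta> > 0"
  obtains K where "compactin B K" "p1 ` K \<inter> p2 ` K = {}" "measure \<mu> (topspace B - K) < \<eta>"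
proof -
  have sets: "sets \<mu> = sets (borel_of B)" and space: "space \<mu> = topspace B" and fin: "finite_measure \<mu>"
    using radon by (auto simp: radon_measure_def)
  interpret finite_measure \<mu> by (rule fin)
  have op: "V \<in> sets \<mu>" if "openin B V" for V using that by (simp add: sets openin_sets_borel_of)
  have "continuous_on offdiag (\<lambda>(x, y). 1 / (1 + dist x y))"
    unfolding case_prod_beta by (intro continuous_intros) (auto simp: add_nonneg_eq_0_iff)
  moreover have "bounded ((\<lambda>(x, y). 1 / (1 + dist x y)) ` offdiag)"
    by (intro boundedI[of _ 1]) (auto simp: field_simps add_pos_nonneg)
  ultimately obtain r where "r \<in> cont_funs B"
      "\<And>x y. x \<noteq> y \<Longrightarrow> r (e (x, y)) = (case (x, y) of (x, y) \<Rightarrow> 1 / (1 + dist x y))"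
    using extend_offdiag by blast
  then have r: "r \<in> cont_funs B" "\<And>x y. x \<noteq> y \<Longrightarrow> r (e (x, y)) = 1 / (1 + dist x y)" by auto
  \<comment> \<open>On actual pairs this says 1/(n+1) < d < n+1. The sets exhaust the region 0 < r <
    1, which carries \<mu>.\<close>
  define A where "A n = {\<xi> \<in> topspace B. 1 / real (Suc (Suc n)) < r \<xi>} \<inter>
    {\<xi> \<in> topspace B. r \<xi> < 1 / (1 + 1 / real (Suc n))}" for n
  have A: "openin B (A n)" for n
    unfolding A_def by (intro openin_Int openin_cont_funs_greater openin_cont_funs_less r)
  have cover: "AE \<zeta> in \<mu>. \<zeta> \<in> (\<Union>n. A n)"
    using conc
  proof (rule AE_mp, intro AE_I2 impI)
    fix \<zeta> assume \<zeta>: "\<zeta> \<in> space \<mu>" "d (p1 \<zeta>) < \<infinity> \<and> d (p2 \<zeta>) < \<infinity> \<and> p1 \<zeta> \<noteq> p2 \<zeta>"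
    then have "0 < r \<zeta>" "r \<zeta> < 1"
      using distance_finite[OF r d] distance_pos[OF r] by (auto simp: space)
    then have "((\<lambda>n. 1 / real (Suc (Suc n))) \<longlonglongrightarrow> 0)" "((\<lambda>n. 1 / (1 + 1 / real (Suc n))) \<longlonglongrightarrow> 1)"
      by real_asymp+
    then have "\<forall>\<^sub>F n in sequentially. 1 / real (Suc (Suc n)) < r \<zeta>"
      "\<forall>\<^sub>F n in sequentially. r \<zeta> < 1 / (1 + 1 / real (Suc n))"
      using \<open>0 < r \<zeta>\<close> \<open>r \<zeta> < 1\<close> by (auto intro: order_tendstoD)
    then have "\<forall>\<^sub>F n in sequentially. \<zeta> \<in> A n"
      by eventually_elim (use \<zeta> in \<open>simp add: A_def space\<close>)
    then show "\<zeta> \<in> (\<Union>n. A n)" by (auto simp: eventually_sequentially)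
  qed
  have "incseq A"
  proof (rule incseq_SucI)
    fix n
    have "1 / real (Suc (Suc (Suc n))) \<le> 1 / real (Suc (Suc n))" by (intro divide_left_mono) auto
    moreover have "1 / (1 + 1 / real (Suc n)) \<le> 1 / (1 + 1 / real (Suc (Suc n)))"
      by (intro divide_left_mono add_left_mono) (auto intro!: mult_pos_pos add_pos_nonneg)
    ultimately show "A n \<le> A (Suc n)" unfolding A_def by fastforce
  qed
  then have "(\<lambda>n. measure \<mu> (A n)) \<longlonglongrightarrow> measure \<mu> (\<Union>n. A n)"
    using op[OF A] by (intro finite_Lim_measure_incseq) auto
  moreover have "measure \<mu> (\<Union>n. A n) = measure \<mu> (topspace B)"
    using cover op[OF A] space sets.top[of \<mu>] by (intro finite_measure_eq_AE) auto
  ultimately have "\<forall>\<^sub>F n in sequentially. measure \<mu> (topspace B) - \<eta>/3 < measure \<mu> (A n)"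
    using \<eta> by (intro order_tendstoD(1)) auto
  then obtain n where n: "measure \<mu> (topspace B) - \<eta>/3 < measure \<mu> (A n)"
    by (auto simp: eventually_sequentially)
  define c where "c = 1 / real (Suc n)"
  define a where "a = 1 / real (Suc (Suc n))"
  define s where "s = a * c / 4"
  have pos: "c > 0" "a > 0" "s > 0" by (auto simp: c_def a_def s_def)
  obtain g where g: "g \<in> G_set B e" "\<And>x y. x \<noteq> y \<Longrightarrow> dist x y * g (e (x, y)) = min (dist x y) c"
    using truncated_distance[OF pos(1)] by blast
  \<comment> \<open>With this bound on the integral, Markov's inequality at level s leaves measure
    below \<eta>/3.\<close>
  have "s * (\<eta>/3) > 0" using pos \<eta> by simp
  from minimal_approximation[OF radon minimal g(1) this] obtain k where
    k: "k \<in> G_set B e" "\<And>\<xi>. \<xi> \<in> topspace B \<Longrightarrow> 0 \<le> k \<xi> + g \<xi>"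
      "(\<integral>\<xi>. k \<xi> + g \<xi> \<partial>\<mu>) < s * (\<eta>/3)" by blast
  note kc = G_set_cont[OF k(1)] and gc = G_set_cont[OF g(1)]
  define S where "S = {\<xi> \<in> topspace B. k \<xi> + g \<xi> < s}"
  have S: "openin B S" unfolding S_def by (intro openin_cont_funs_less cont_funs_add kc gc)
  have "measure \<mu> {\<xi> \<in> space \<mu>. s \<le> k \<xi> + g \<xi>} \<le> (\<integral>\<xi>. k \<xi> + g \<xi> \<partial>\<mu>) / s"
    using k(2) pos(3) space
    by (intro integral_Markov_inequality_measure[where A="{}"] cont_funs_integrable[OF compact_B _ fin sets]
        cont_funs_add kc gc) auto
  also have "\<dots> < \<eta>/3" using k(3) pos(3) by (simp add: field_simps)
  also have "{\<xi> \<in> space \<mu>. s \<le> k \<xi> + g \<xi>} = topspace B - S" by (auto simp: S_def space)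
  finally have mS: "measure \<mu> (topspace B - S) < \<eta>/3" .
  have AS: "A n \<inter> S \<in> sets \<mu>" using op[OF A] op[OF S] by auto
  have mA: "measure \<mu> (topspace B - A n) < \<eta>/3"
    using finite_measure_compl[OF op[OF A[of n]]] n by (simp add: space)
  have "measure \<mu> ((topspace B - A n) \<union> (topspace B - S))
      \<le> measure \<mu> (topspace B - A n) + measure \<mu> (topspace B - S)"
    using op[OF A[of n]] op[OF S] sets.compl_sets[of _ \<mu>] by (intro measure_Un_le) (auto simp: space)
  then have mAS: "measure \<mu> (topspace B) - measure \<mu> (A n \<inter> S) < 2 * \<eta>/3"
    using finite_measure_compl[OF AS] mA mS by (simp add: space Diff_Int)
  have disj: "p1 ` (A n \<inter> S) \<inter> p2 ` (A n \<inter> S) = {}"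
    by (rule disjoint_projections[OF r gc g(2) k(1,2) pos(1,2), of s])
      (simp_all add: A_def S_def a_def c_def s_def)
  have sup: "emeasure \<mu> (A n \<inter> S) = (SUP K\<in>{K. compactin B K \<and> K \<subseteq> A n \<inter> S}. emeasure \<mu> K)"
    using radon AS unfolding radon_measure_def by blast
  have "\<exists>K. compactin B K \<and> K \<subseteq> A n \<inter> S \<and> measure \<mu> (A n \<inter> S) - \<eta>/3 < measure \<mu> K"
  \<comment> \<open>\<open>ennreal\<close> sends negative reals to 0, so the strict comparison with
    the supremum requires positive measure; otherwise the empty set serves.\<close>
  proof (cases "measure \<mu> (A n \<inter> S) > 0")
    case False
    then have "measure \<mu> (A n \<inter> S) - \<eta>/3 < measure \<mu> {}" using \<eta> by simp
    then show ?thesis by (intro exI[of _ "{}"]) auto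
  next
    case True
    then have "ennreal (measure \<mu> (A n \<inter> S) - \<eta>/3) < emeasure \<mu> (A n \<inter> S)"
      using \<eta> by (simp add: emeasure_eq_measure ennreal_lessI)
    then obtain K where "compactin B K" "K \<subseteq> A n \<inter> S"
        "ennreal (measure \<mu> (A n \<inter> S) - \<eta>/3) < ennreal (measure \<mu> K)"
      unfolding sup by (auto simp: less_SUP_iff emeasure_eq_measure)
    then show ?thesis by (meson ennreal_leI leD not_le)
  qed
  then obtain K where K: "compactin B K" "K \<subseteq> A n \<inter> S" "measure \<mu> (A n \<inter> S) - \<eta>/3 < measure \<mu> K"
    by blast
  have "K \<in> sets \<mu>"
    using compactin_imp_closedin[OF Hausdorff_B K(1)] by (simp add: sets closedin_sets_borel_of)
  then have "measure \<mu> (topspace B - K) < \<eta>"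
    using finite_measure_compl[of K] K(3) mAS by (simp add: space)
  then show ?thesis using that[OF K(1)] disj K(2) by blast
qed

end

section \<open>Mutual singularity of the marginals\<close>

theorem theorem4p9:
  fixes z0 :: "'a::complete_space"
    and B :: "'b topology" and e :: "'a \<times> 'a \<Rightarrow> 'b"
    and U :: "'u topology" and i :: "'a \<Rightarrow> 'u"
    and p1 p2 :: "'b \<Rightarrow> 'u" and d0bar :: "'u \<Rightarrow> ennreal"
    and \<mu> :: "'b measure"
  assumes three: "\<exists>a b c :: 'a. a \<noteq> b \<and> b \<noteq> c \<and> a \<noteq> c"
    and SC: "stone_cech_compactification
               (subtopology euclidean {(x, y). x \<noteq> y}) B e"
    and UC: "uniform_compactification U i"
    and p1: "continuous_map B U p1" "\<forall>x y. x \<noteq> y \<longrightarrow> p1 (e (x, y)) = i x"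
    and p2: "continuous_map B U p2" "\<forall>x y. x \<noteq> y \<longrightarrow> p2 (e (x, y)) = i y"
    and d0: "continuous_map U euclidean d0bar" "\<forall>x. d0bar (i x) = ennreal (dist x z0)"
    and radon: "radon_measure B \<mu>"
    and minimal: "preceq_minimal B e \<mu>"
    and conc: "AE \<zeta> in \<mu>. d0bar (p1 \<zeta>) < \<infinity> \<and> d0bar (p2 \<zeta>) < \<infinity> \<and> p1 \<zeta> \<noteq> p2 \<zeta>"
  shows "mutually_singular (distr \<mu> (borel_of U) p1) (distr \<mu> (borel_of U) p2)"
proof -
  interpret compactified_pairs B e U i p1 p2
    by unfold_locales (use assms in auto)
  have sets: "sets \<mu> = sets (borel_of B)" and space: "space \<mu> = topspace B" and fin: "finite_measure \<mu>"
    using radon by (auto simp: radon_measure_def)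
  interpret finite_measure \<mu> by (rule fin)
  have meas: "p1 \<in> measurable \<mu> (borel_of U)" "p2 \<in> measurable \<mu> (borel_of U)"
    by (rule continuous_map_measurable_borel_of[OF p1(1) sets],
        rule continuous_map_measurable_borel_of[OF p2(1) sets])
  have "\<exists>K. compactin B K \<and> p1 ` K \<inter> p2 ` K = {} \<and> measure \<mu> (topspace B - K) < (1/2) ^ n" for n :: nat
    using compact_with_disjoint_projections[OF radon minimal d0(1) _ conc, of z0 "(1/2) ^ n"] d0(2)
    by (metis half_gt_zero zero_less_one zero_less_power)
  then obtain K where K: "\<And>n. compactin B (K n)" "\<And>n. p1 ` K n \<inter> p2 ` K n = {}"
    "\<And>n::nat. measure \<mu> (topspace B - K n) < (1/2) ^ n" by metis
  have KB: "K n \<in> sets \<mu>" for n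
    using compactin_imp_closedin[OF Hausdorff_B K(1)] by (simp add: sets closedin_sets_borel_of)
  \<comment> \<open>Compact, hence Borel, in \<open>U\<close>. The p1-preimage of its complement
    and, by disjointness of the images, the p2-preimage of \<open>C n\<close> itself both avoid
    \<open>K n\<close>.\<close>
  define C where "C n = p1 ` K n" for n
  have C: "C n \<in> sets (borel_of U)" for n
    unfolding C_def
    by (intro closedin_sets_borel_of compactin_imp_closedin[OF Hausdorff_U] image_compactin[OF K(1) p1(1)])
  have CU: "C n \<subseteq> topspace U" for n using sets.sets_into_space[OF C] by simp
  \<comment> \<open>Stated for general p and F because it is used twice: for p1 with the complements
    of the \<open>C n\<close>, and for p2 with the \<open>C n\<close>. The bounds (1/2)^n make the
    measures summable.\<close>
  have small: "limsup F \<in> null_sets (distr \<mu> (borel_of U) p)"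
    if p: "p \<in> measurable \<mu> (borel_of U)" and F: "\<And>n. F n \<in> sets (borel_of U)"
      and FK: "\<And>n. p -` F n \<inter> topspace B \<subseteq> topspace B - K n" for p F
  proof -
    interpret D: finite_measure "distr \<mu> (borel_of U) p" by (rule finite_measure_distr[OF p])
    have le: "measure (distr \<mu> (borel_of U) p) (F n) \<le> (1/2) ^ n" for n
    proof -
      have "measure (distr \<mu> (borel_of U) p) (F n) = measure \<mu> (p -` F n \<inter> topspace B)"
        by (simp add: measure_distr[OF p F] space)
      also have "\<dots> \<le> measure \<mu> (topspace B - K n)"
        using FK KB sets.compl_sets[OF KB[of n]] by (intro finite_measure_mono) (auto simp: space)
      finally show ?thesis using K(3)[of n] by linarith
    qed
    show ?thesis
    proof (rule borel_cantelli_limsup1)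
      show "summable (\<lambda>n. measure (distr \<mu> (borel_of U) p) (F n))"
        by (rule summable_comparison_test'[where g="\<lambda>n. (1/2) ^ n" and N=0]) (use le in \<open>auto intro: summable_geometric\<close>)
    qed (use F in \<open>auto simp: less_top[symmetric]\<close>)
  qed
  \<comment> \<open>A point of \<open>U\<close> outside this upper limit lies in all but finitely
    many \<open>C n\<close>, hence in \<open>limsup C\<close>. So one set is null for the first
    marginal while its complement is null for the second.\<close>
  let ?A = "limsup (\<lambda>n. topspace U - C n)"
  have A: "?A \<in> null_sets (distr \<mu> (borel_of U) p1)"
    by (rule small[OF meas(1)]) (use C sets.compl_sets[OF C] in \<open>auto simp: C_def\<close>)
  have A': "limsup C \<in> null_sets (distr \<mu> (borel_of U) p2)"
    by (rule small[OF meas(2) C]) (use K(2) in \<open>auto simp: C_def\<close>)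
  have "topspace U - ?A \<subseteq> limsup C"
  proof
    fix \<xi> assume "\<xi> \<in> topspace U - ?A"
    then obtain n where n: "\<And>m. m \<ge> n \<Longrightarrow> \<xi> \<in> C m" by (auto simp: limsup_INF_SUP)
    have "\<exists>m\<ge>l. \<xi> \<in> C m" for l using n[of "max l n"] by (intro exI[of _ "max l n"]) auto
    then show "\<xi> \<in> limsup C" by (auto simp: limsup_INF_SUP)
  qed
  moreover have "topspace U - ?A \<in> sets (distr \<mu> (borel_of U) p2)"
    using A sets.compl_sets[of ?A "borel_of U"] by auto
  ultimately have "topspace U - ?A \<in> null_sets (distr \<mu> (borel_of U) p2)"
    using A' null_sets_subset by blast
  then show ?thesis
    using A unfolding mutually_singular_def by (intro bexI[of _ ?A]) auto
qed

end
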